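(* Assume (A1), and assume (C2) holds for some $0<q<2$. Then $$\sup_{x\in[0,1]^d}|g_n(x)-Eg_n(x)|=O_{a.s.}\!\left[\frac{(\log n)^{1/q}}{(nh_n)^{d/2}}\right].$$
   Context: Fix an integer $d\ge1$. For $x=(x_1,\dots,x_d)\in\mathbb{R}^d$ let $\|x\|=\max_{1\le k\le d}|x_k|$; for $i,j\in\mathbb{Z}^d$ let $|i-j|=\max_{1\le l\le d}|i_l-j_l|$, and $|k|=|k-0|$. Let $(\varepsilon_i)_{i\in\mathbb{Z}^d}$ be a strictly stationary real random field on a probability space $(\Omega,\mathcal F,\mathbb P)$ with $E\varepsilon_0=0$. Strict stationarity means: for all $k\in\mathbb{Z}^d$, $n\ge1$ and $i_1,\dots,i_n\in\mathbb{Z}^d$, the vectors $(\varepsilon_{i_1},\dots,\varepsilon_{i_n})$ and $(\varepsilon_{i_1+k},\dots,\varepsilon_{i_n+k})$ have the same law. Let $g:[0,1]^d\to\mathbb{R}$ and $\Lambda_n=\{1,\dots,n\}^d$, and set $Y_i=g(i/n)+\varepsilon_i$ for $i\in\Lambda_n$. Let $K$ be a probability density on $\mathbb{R}^d$ and $(h_n)_{n\ge1}$ positive numbers with $h_n\to0$ and $nh_n\to\infty$. For $x\in[0,1]^d$ define $$g_n(x)=\frac{\sum_{i\in\Lambda_n}Y_i\,K\big((x-i/n)/h_n\big)}{\sum_{i\in\Lambda_n}K\big((x-i/n)/h_n\big)}.$$ Assumption (A1): $K$ is symmetric and nonnegative, and supported in $[-1,1]^d$. There is $\eta>0$ with $|K(x)-K(y)|\le\eta\|x-y\|$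 for all $x,y\in[-1,1]^d$, and there are constants $c,C>0$ with $c\le K(x)\le C$ for all $x\in[-1,1]^d$. Notation $O_{a.s.}$: for real random variables $Z_n$ and positive numbers $v_n$, $Z_n=O_{a.s.}[v_n]$ means there exists a deterministic $\lambda>0$ with $\limsup_{n\to\infty}|Z_n|/v_n\le\lambda$ almost surely. Dependence notation: $i<_{lex}j$ for distinct $i,j\in\mathbb{Z}^d$ means either $i_1<j_1$, or for some $p\in\{2,\dots,d\}$ one has $i_p<j_p$ and $i_q=j_q$ for $1\le q<p$. Set $V_i^1=\{j\in\mathbb{Z}^d: j<_{lex}i\}$ and, for integers $m\ge2$, $V_i^m=V_i^1\cap\{j:|i-j|\ge m\}$. For $\Gamma\subset\mathbb{Z}^d$ let $\mathcal F_\Gamma=\sigma(\varepsilon_j: j\in\Gamma)$. For $k\in V_0^1$ (so $|k|\ge1$) put $E_{|k|}(\varepsilon_0)=E(\varepsilon_0\mid\mathcal F_{V_0^{|k|}})$. Orlicz notation: for $\beta>0$ let $\psi_\beta(x)=\exp((x+\xi_\beta)^\beta)-\exp(\xi_\beta^\beta)$ for $x\ge0$, where $\xi_\beta=((1-\beta)/\beta)^{1/\beta}$ if $0<\beta<1$ and $\xi_\beta=0$ otherwise. For a real random variable $Z$, $\|Z\|_{\psi_\beta}=\inf\{c>0: E[\psi_\beta(|Z|/c)]\le1\}$, and $L_{\psi_\beta}$ is the space of $Z$ with $\|Z\|_{\psi_\beta}<\infty$. For $0<q<2$ let $\beta(q)=2q/(2-q)$. Condition (C2) (for a given $0<q<2$):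 $\varepsilon_0\in L_{\psi_{\beta(q)}}$ and $\sum_{k\in V_0^1}\big\|\sqrt{|\varepsilon_kE_{|k|}(\varepsilon_0)|}\big\|_{\psi_{\beta(q)}}^2<\infty$. *)

theory Defs
  imports "HOL-Analysis.Analysis" "HOL-Probability.Probability"
begin

text \<open>Dimension d = CARD('d); coordinates indexed by a finite linearly ordered type 'd
  (the order on 'd plays the role of the order 1 < ... < d of coordinates).\<close>

definition maxnorm :: "real^'d::finite \<Rightarrow> real" where
  "maxnorm x = Max (range (\<lambda>k. \<bar>x $ k\<bar>))"

definition idist :: "int^'d::finite \<Rightarrow> int^'d \<Rightarrow> int" where
  "idist i j = Max (range (\<lambda>l. \<bar>i $ l - j $ l\<bar>))"

definition lex_less :: "(int, 'd::{finite,linorder}) vec \<Rightarrow> (int, 'd) vec \<Rightarrow> bool" where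
  "lex_less i j \<longleftrightarrow> (\<exists>p. i $ p < j $ p \<and> (\<forall>q<p. i $ q = j $ q))"

text \<open>V_i^m (for m = 1 the distance condition is automatic).\<close>
definition Vset :: "int \<Rightarrow> (int, 'd::{finite,linorder}) vec \<Rightarrow> (int, 'd) vec set" where
  "Vset m i = {j. lex_less j i \<and> idist i j \<ge> m}"

definition field_sigma :: "'a measure \<Rightarrow> ('i \<Rightarrow> 'a \<Rightarrow> real) \<Rightarrow> 'i set \<Rightarrow> 'a measure" where
  "field_sigma M eps \<Gamma> =
     sigma (space M) {eps j -` A \<inter> space M | j A. j \<in> \<Gamma> \<and> A \<in> sets borel}"

definition xi_beta :: "real \<Rightarrow> real" where
  "xi_beta \<beta> = (if 0 < \<beta> \<and> \<beta> < 1 then ((1 - \<beta>) / \<beta>) powr (1 / \<beta>) else 0)"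

definition psi_beta :: "real \<Rightarrow> real \<Rightarrow> real" where
  "psi_beta \<beta> x = exp ((x + xi_beta \<beta>) powr \<beta>) - exp (xi_beta \<beta> powr \<beta>)"

text \<open>Orlicz norm, valued in [0,\<infinity>] (\<infinity> when no admissible c exists).\<close>
definition orlicz_norm :: "'a measure \<Rightarrow> real \<Rightarrow> ('a \<Rightarrow> real) \<Rightarrow> ennreal" where
  "orlicz_norm M \<beta> Z =
     Inf {ennreal c | c. c > 0 \<and> (\<integral>\<^sup>+ \<omega>. ennreal (psi_beta \<beta> (\<bar>Z \<omega>\<bar> / c)) \<partial>M) \<le> 1}"

definition beta_of :: "real \<Rightarrow> real" where
  "beta_of q = 2 * q / (2 - q)"

definition strictly_stationary ::
  "'a measure \<Rightarrow> (int^'d::finite \<Rightarrow> 'a \<Rightarrow> real) \<Rightarrow> bool" where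
  "strictly_stationary M eps \<longleftrightarrow>
     (\<forall>k (is :: (int, 'd) vec list). 
        distr M (PiM {..<length is} (\<lambda>_. borel)) (\<lambda>\<omega>. \<lambda>m\<in>{..<length is}. eps (is ! m) \<omega>)
      = distr M (PiM {..<length is} (\<lambda>_. borel)) (\<lambda>\<omega>. \<lambda>m\<in>{..<length is}. eps (is ! m + k) \<omega>))"

definition Lam :: "nat \<Rightarrow> (int^'d::finite) set" where
  "Lam n = {i. \<forall>k. 1 \<le> i $ k \<and> i $ k \<le> int n}"

definition scaled :: "nat \<Rightarrow> int^'d::finite \<Rightarrow> real^'d" where
  "scaled n i = (\<chi> k. real_of_int (i $ k) / real n)"

definition unit_cube :: "(real^'d::finite) set" where
  "unit_cube = {x. \<forall>k. 0 \<le> x $ k \<and> x $ k \<le> 1}"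

definition gn :: "(int^'d::finite \<Rightarrow> 'a \<Rightarrow> real) \<Rightarrow> (real^'d \<Rightarrow> real) \<Rightarrow> (real^'d \<Rightarrow> real)
    \<Rightarrow> (nat \<Rightarrow> real) \<Rightarrow> nat \<Rightarrow> real^'d \<Rightarrow> 'a \<Rightarrow> real" where
  "gn eps g K h n x \<omega> =
     (\<Sum>i\<in>Lam n. (g (scaled n i) + eps i \<omega>) * K ((1 / h n) *\<^sub>R (x - scaled n i)))
     / (\<Sum>i\<in>Lam n. K ((1 / h n) *\<^sub>R (x - scaled n i)))"

definition A1 :: "(real^'d::finite \<Rightarrow> real) \<Rightarrow> bool" where
  "A1 K \<longleftrightarrow>
     (\<forall>x. K (- x) = K x) \<and> (\<forall>x. K x \<ge> 0) \<and> (\<forall>x. K x \<noteq> 0 \<longrightarrow> maxnorm x \<le> 1) \<and>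
     (\<exists>\<eta>>0. \<forall>x y. maxnorm x \<le> 1 \<longrightarrow> maxnorm y \<le> 1 \<longrightarrow> \<bar>K x - K y\<bar> \<le> \<eta> * maxnorm (x - y)) \<and>
     (\<exists>c C. 0 < c \<and> 0 < C \<and> (\<forall>x. maxnorm x \<le> 1 \<longrightarrow> c \<le> K x \<and> K x \<le> C))"

definition prob_density :: "(real^'d::finite \<Rightarrow> real) \<Rightarrow> bool" where
  "prob_density K \<longleftrightarrow> (\<forall>x. K x \<ge> 0) \<and> integrable lborel K \<and> integral\<^sup>L lborel K = 1"

definition C2 :: "'a measure \<Rightarrow> ((int, 'd::{finite,linorder}) vec \<Rightarrow> 'a \<Rightarrow> real) \<Rightarrow> real \<Rightarrow> bool" where
  "C2 M eps q \<longleftrightarrow>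
     orlicz_norm M (beta_of q) (eps 0) < \<infinity> \<and>
     (\<integral>\<^sup>+ k. (orlicz_norm M (beta_of q)
         (\<lambda>\<omega>. sqrt \<bar>eps k \<omega> * real_cond_exp M (field_sigma M eps (Vset (idist k 0) 0)) (eps 0) \<omega>\<bar>)) ^ 2
       \<partial>count_space (Vset 1 0)) < \<infinity>"

end

theory Submission
  imports Defs
begin

text \<open>Write the centred estimator as \<open>S = \<Sum> w\<^sub>i \<epsilon>\<^sub>i\<close> with deterministic weights. Expanding
  \<open>S ^ (2 m)\<close> one site at a time in lexicographic order, each new site after a shift being the origin,
  gives a polynomial version of Dedecker's moment inequality, \<open>\<parallel>S\<parallel>\<^sup>2 \<le> 8 m \<Sum> b\<^sub>i\<close> for the norm of
  order \<open>2 m\<close>, where \<open>b\<^sub>i\<close> collects the norms of order \<open>m\<close> of the products \<open>\<epsilon>\<^sub>k E\<^sub>|\<^sub>k\<^sub>| \<epsilon>\<^sub>0\<close>.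
  Under (C2) the latter grow like \<open>m powr (2 / \<beta>)\<close>, and \<open>1 + 2 / \<beta> = 2 / q\<close>, so Markov's inequality with
  \<open>m\<close> of order \<open>log n\<close> bounds the deviations at a single point by \<open>(log n) powr (1 / q)\<close> standard
  deviations outside an event of arbitrarily small polynomial probability. A net of polynomial size and
  the Borel-Cantelli lemma conclude.\<close>

subsection \<open>Elementary inequalities\<close>

lemma power_mult_power_le_weighted_sum:
  fixes u v :: real
  assumes "0 \<le> u" "0 \<le> v" "0 < k" "k < n"
  shows "u ^ (n - k) * v ^ k \<le> (real (n - k) * u ^ n + real k * v ^ n) / real n"
proof -
  have root_powr: "(w ^ l) powr (real n / real l) = w ^ n" if "0 \<le> w" "0 < l" for w :: real and l
    using that assms(4) by (cases "w = 0") (auto simp: powr_powr power_0_left simp flip: powr_realpow)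
  have "u ^ (n - k) * v ^ k
      \<le> (u ^ (n - k)) powr (real n / real (n - k)) / (real n / real (n - k))
        + (v ^ k) powr (real n / real k) / (real n / real k)"
    using assms by (intro Youngs_inequality) (auto simp: field_simps of_nat_diff)
  then show ?thesis
    using assms root_powr[of u "n - k"] root_powr[of v k]
    by (simp add: add_divide_distrib mult.commute)
qed

lemma power_mult_power_le_add:
  fixes u v :: real
  assumes "0 \<le> u" "0 \<le> v"
  shows "u ^ a * v ^ b \<le> u ^ (a + b) + v ^ (a + b)"
proof (cases "u \<le> v")
  case True
  then have "u ^ a * v ^ b \<le> v ^ a * v ^ b" using assms by (intro mult_right_mono power_mono) auto
  then show ?thesis using assms by (simp add: power_add add_increasing)
next
  case False
  then have "u ^ a * v ^ b \<le> u ^ a * u ^ b" using assms by (intro mult_left_mono power_mono) auto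
  then show ?thesis using assms by (simp add: power_add add_increasing2)
qed

lemma power_abs_add_le:
  fixes x y :: real
  shows "\<bar>x + y\<bar> ^ n \<le> 2 ^ n * (\<bar>x\<bar> ^ n + \<bar>y\<bar> ^ n)"
proof -
  have "\<bar>x + y\<bar> ^ n \<le> (2 * max \<bar>x\<bar> \<bar>y\<bar>) ^ n" by (intro power_mono) auto
  also have "\<dots> \<le> 2 ^ n * (\<bar>x\<bar> ^ n + \<bar>y\<bar> ^ n)" by (auto simp: power_mult_distrib max_def)
  finally show ?thesis .
qed

lemma abs_sum_power_mult_power_le:
  fixes u v :: real
  shows "\<bar>\<Sum>i<n. u ^ (n - Suc i) * v ^ i\<bar> \<le> real n * (\<bar>u\<bar> ^ (n - 1) + \<bar>v\<bar> ^ (n - 1))"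
proof -
  have "\<bar>\<Sum>i<n. u ^ (n - Suc i) * v ^ i\<bar> \<le> (\<Sum>i<n. \<bar>u\<bar> ^ (n - Suc i) * \<bar>v\<bar> ^ i)"
    by (rule order_trans[OF sum_abs]) (simp add: abs_mult power_abs)
  also have "\<dots> \<le> (\<Sum>i<n. \<bar>u\<bar> ^ (n - 1) + \<bar>v\<bar> ^ (n - 1))"
  proof (rule sum_mono)
    fix i assume "i \<in> {..<n}"
    then have "n - Suc i + i = n - 1" by auto
    then show "\<bar>u\<bar> ^ (n - Suc i) * \<bar>v\<bar> ^ i \<le> \<bar>u\<bar> ^ (n - 1) + \<bar>v\<bar> ^ (n - 1)"
      using power_mult_power_le_add[of "\<bar>u\<bar>" "\<bar>v\<bar>" "n - Suc i" i] by simp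
  qed
  finally show ?thesis by simp
qed

lemma power_add_ge_first_order:
  fixes a b :: real
  assumes "0 \<le> a" "0 \<le> b"
  shows "a ^ n + real n * b * a ^ (n - 1) \<le> (a + b) ^ n"
proof (induction n)
  case (Suc n)
  show ?case
  proof (cases n)
    case n: (Suc l)
    have "a ^ Suc n + real (Suc n) * b * a ^ n \<le> (a + b) * (a ^ n + real n * b * a ^ (n - 1))"
      using assms by (simp add: n algebra_simps)
    also have "\<dots> \<le> (a + b) * (a + b) ^ n"
      using Suc assms by (intro mult_left_mono) auto
    finally show ?thesis by simp
  qed simp
qed simp

lemma one_plus_power_le_second_order:
  fixes x :: real
  assumes "0 \<le> x" "real n * x \<le> 1"
  shows "(1 + x) ^ n \<le> 1 + real n * x + (real n * x)\<^sup>2"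
proof -
  have "(1 + x) ^ n \<le> exp x ^ n" using assms(1) exp_ge_add_one_self[of x] by (intro power_mono) auto
  also have "\<dots> = exp (real n * x)" by (simp flip: exp_of_nat_mult)
  also have "\<dots> \<le> 1 + real n * x + (real n * x)\<^sup>2" using assms by (intro exp_bound) auto
  finally show ?thesis .
qed

lemma power_add_le_second_order:
  fixes a b :: real
  assumes "0 < a" "0 \<le> b" "real (n + 2) * b \<le> a"
  shows "(a + b) ^ (n + 2)
    \<le> a ^ (n + 2) + real (n + 2) * a ^ (n + 1) * b + (real (n + 2) * b)\<^sup>2 * a ^ n"
proof -
  have "(a + b) ^ (n + 2) = a ^ (n + 2) * (1 + b / a) ^ (n + 2)"
    using assms(1) by (subst power_mult_distrib[symmetric]) (simp add: distrib_left)
  also have "\<dots> \<le> a ^ (n + 2) * (1 + real (n + 2) * (b / a) + (real (n + 2) * (b / a))\<^sup>2)"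
    using assms by (intro mult_left_mono one_plus_power_le_second_order) (auto simp: divide_le_eq)
  also have "\<dots> = a ^ (n + 2) + real (n + 2) * a ^ (n + 1) * b + (real (n + 2) * b)\<^sup>2 * a ^ n"
    using assms(1) by (simp add: distrib_left power2_eq_square)
  finally show ?thesis .
qed

text \<open>The first order term is kept apart so that the factor of \<open>b\<^sup>2\<close> stays linear in \<open>m\<close>.\<close>
lemma power_add_le_shifted_square:
  fixes a b :: real
  assumes "0 \<le> a" "0 \<le> b" "1 \<le> m"
  shows "(a + b) ^ (2 * m) \<le> (a\<^sup>2 + 8 * real m * b\<^sup>2) ^ m + 2 * real m * a ^ (2 * m - 1) * b"
proof (cases "a \<le> 2 * real m * b")
  case True
  have "a * b \<le> 2 * real m * b * b" using True assms by (intro mult_right_mono) auto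
  then have "2 * a * b \<le> 4 * (real m * b\<^sup>2)" by (simp add: power2_eq_square mult_ac)
  moreover have "0 \<le> b\<^sup>2" "b\<^sup>2 \<le> real m * b\<^sup>2" using assms by (auto simp: mult_le_cancel_right1)
  ultimately have "(a + b)\<^sup>2 \<le> a\<^sup>2 + 8 * real m * b\<^sup>2"
    unfolding power2_sum by linarith
  then have "((a + b)\<^sup>2) ^ m \<le> (a\<^sup>2 + 8 * real m * b\<^sup>2) ^ m" by (intro power_mono) auto
  moreover have "0 \<le> 2 * real m * a ^ (2 * m - 1) * b" using assms by simp
  ultimately show ?thesis unfolding power_mult by linarith
next
  case False
  then have pos: "a > 0" using assms by (smt (verit) mult_nonneg_nonneg of_nat_0_le_iff)
  obtain l where m: "m = Suc l" using assms(3) by (cases m) auto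
  have "(a + b) ^ (2 * m) \<le> (a\<^sup>2) ^ m + real m * (4 * real m * b\<^sup>2) * (a\<^sup>2) ^ (m - 1)
      + 2 * real m * a ^ (2 * m - 1) * b"
    using power_add_le_second_order[of a b "2 * l"] False pos assms(2)
    by (simp add: m power_mult power_mult_distrib power2_eq_square algebra_simps)
  also have "(a\<^sup>2) ^ m + real m * (4 * real m * b\<^sup>2) * (a\<^sup>2) ^ (m - 1) \<le> (a\<^sup>2 + 4 * real m * b\<^sup>2) ^ m"
    by (intro power_add_ge_first_order) auto
  also have "\<dots> \<le> (a\<^sup>2 + 8 * real m * b\<^sup>2) ^ m" by (intro power_mono) auto
  finally show ?thesis by simp
qed

subsection \<open>Random variables with moments of all orders\<close>

definition all_moments :: "'a measure \<Rightarrow> ('a \<Rightarrow> real) \<Rightarrow> bool" where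
  "all_moments M f \<longleftrightarrow> f \<in> borel_measurable M \<and> (\<forall>n. integrable M (\<lambda>\<omega>. \<bar>f \<omega>\<bar> ^ n))"

lemma all_momentsD:
  assumes "all_moments M f"
  shows "f \<in> borel_measurable M" "integrable M (\<lambda>\<omega>. \<bar>f \<omega>\<bar> ^ n)" "integrable M f"
proof -
  show [measurable]: "f \<in> borel_measurable M" and int: "\<And>n. integrable M (\<lambda>\<omega>. \<bar>f \<omega>\<bar> ^ n)"
    using assms by (auto simp: all_moments_def)
  show "integrable M f"
    by (rule Bochner_Integration.integrable_bound[OF int[of 1]]) auto
qed

lemma (in finite_measure) all_moments_of_even_powers:
  assumes [measurable]: "f \<in> borel_measurable M" and int: "\<And>n. integrable M (\<lambda>\<omega>. f \<omega> ^ (2 * n))"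
  shows "all_moments M f"
  unfolding all_moments_def
proof safe
  fix n
  show "integrable M (\<lambda>\<omega>. \<bar>f \<omega>\<bar> ^ n)"
  proof (rule Bochner_Integration.integrable_bound)
    show "integrable M (\<lambda>\<omega>. 1 + f \<omega> ^ (2 * n))" using int by simp
    have "\<bar>x\<bar> ^ n \<le> 1 + x ^ (2 * n)" for x :: real
      using power_mult_power_le_add[of 1 "\<bar>x\<bar>" n n] by (simp add: power_even_abs flip: mult_2)
    then show "AE \<omega> in M. norm (\<bar>f \<omega>\<bar> ^ n) \<le> norm (1 + f \<omega> ^ (2 * n))"
      by auto
  qed measurable
qed measurable

lemma all_moments_abs: "all_moments M f \<Longrightarrow> all_moments M (\<lambda>\<omega>. \<bar>f \<omega>\<bar>)"
  by (auto simp: all_moments_def)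

lemma (in finite_measure) all_moments_const: "all_moments M (\<lambda>_. c)"
  by (auto simp: all_moments_def)

lemma all_moments_mult:
  assumes "all_moments M f" "all_moments M g"
  shows "all_moments M (\<lambda>\<omega>. f \<omega> * g \<omega>)"
  unfolding all_moments_def
proof safe
  note [measurable] = all_momentsD(1)[OF assms(1)] all_momentsD(1)[OF assms(2)]
  show "(\<lambda>\<omega>. f \<omega> * g \<omega>) \<in> borel_measurable M" by measurable
  fix n
  show "integrable M (\<lambda>\<omega>. \<bar>f \<omega> * g \<omega>\<bar> ^ n)"
  proof (rule Bochner_Integration.integrable_bound)
    show "integrable M (\<lambda>\<omega>. \<bar>f \<omega>\<bar> ^ (n + n) + \<bar>g \<omega>\<bar> ^ (n + n))"
      by (intro Bochner_Integration.integrable_add all_momentsD assms)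
    show "AE \<omega> in M. norm (\<bar>f \<omega> * g \<omega>\<bar> ^ n) \<le> norm (\<bar>f \<omega>\<bar> ^ (n + n) + \<bar>g \<omega>\<bar> ^ (n + n))"
      using power_mult_power_le_add[of "\<bar>f _\<bar>" "\<bar>g _\<bar>" n n] by (simp add: abs_mult power_mult_distrib)
  qed measurable
qed

lemma all_moments_add:
  assumes "all_moments M f" "all_moments M g"
  shows "all_moments M (\<lambda>\<omega>. f \<omega> + g \<omega>)"
  unfolding all_moments_def
proof safe
  note [measurable] = all_momentsD(1)[OF assms(1)] all_momentsD(1)[OF assms(2)]
  show "(\<lambda>\<omega>. f \<omega> + g \<omega>) \<in> borel_measurable M" by measurable
  fix n
  show "integrable M (\<lambda>\<omega>. \<bar>f \<omega> + g \<omega>\<bar> ^ n)"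
  proof (rule Bochner_Integration.integrable_bound)
    show "integrable M (\<lambda>\<omega>. 2 ^ n * (\<bar>f \<omega>\<bar> ^ n + \<bar>g \<omega>\<bar> ^ n))"
      by (intro integrable_mult_right Bochner_Integration.integrable_add all_momentsD assms)
    show "AE \<omega> in M. norm (\<bar>f \<omega> + g \<omega>\<bar> ^ n) \<le> norm (2 ^ n * (\<bar>f \<omega>\<bar> ^ n + \<bar>g \<omega>\<bar> ^ n))"
      by (auto intro!: power_abs_add_le)
  qed measurable
qed

lemma (in finite_measure) all_moments_sum:
  "(\<And>j. j \<in> A \<Longrightarrow> all_moments M (f j)) \<Longrightarrow> all_moments M (\<lambda>\<omega>. \<Sum>j\<in>A. f j \<omega>)"
  by (induction A rule: infinite_finite_induct) (auto intro: all_moments_const all_moments_add)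

lemma (in finite_measure) all_moments_power:
  "all_moments M f \<Longrightarrow> all_moments M (\<lambda>\<omega>. f \<omega> ^ n)"
  by (induction n) (auto intro: all_moments_const all_moments_mult)

lemmas (in finite_measure) all_moments_intros =
  all_moments_const all_moments_mult all_moments_add all_moments_sum all_moments_power
  all_moments_abs

lemma (in finite_measure_subalgebra) all_moments_real_cond_exp:
  assumes "all_moments M f"
  shows "all_moments M (real_cond_exp M F f)"
proof (rule all_moments_of_even_powers)
  fix n
  show "integrable M (\<lambda>\<omega>. real_cond_exp M F f \<omega> ^ (2 * n))"
    using assms
    by (intro integrable_convex_cond_exp[where I = UNIV] convex_power_even)
       (auto intro: all_momentsD(3) all_moments_power)
qed simp

subsection \<open>Moment norms\<close>

definition Lp_norm :: "'a measure \<Rightarrow> nat \<Rightarrow> ('a \<Rightarrow> real) \<Rightarrow> real" where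
  "Lp_norm M p X = root p (\<integral>\<omega>. \<bar>X \<omega>\<bar> ^ p \<partial>M)"

lemma Lp_norm_nonneg: "0 \<le> Lp_norm M p X"
  by (simp add: Lp_norm_def real_root_ge_zero)

lemma Lp_norm_power: "0 < p \<Longrightarrow> Lp_norm M p X ^ p = (\<integral>\<omega>. \<bar>X \<omega>\<bar> ^ p \<partial>M)"
  by (simp add: Lp_norm_def)

lemma Lp_norm_le_iff:
  assumes "0 < p" "0 \<le> a"
  shows "Lp_norm M p X \<le> a \<longleftrightarrow> (\<integral>\<omega>. \<bar>X \<omega>\<bar> ^ p \<partial>M) \<le> a ^ p"
  using assms by (simp add: Lp_norm_nonneg flip: Lp_norm_power)

lemma Lp_norm_square_le_iff:
  assumes "1 \<le> m" "0 \<le> a"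
  shows "(Lp_norm M (2 * m) X)\<^sup>2 \<le> a \<longleftrightarrow> (\<integral>\<omega>. X \<omega> ^ (2 * m) \<partial>M) \<le> a ^ m"
proof -
  have "((Lp_norm M (2 * m) X)\<^sup>2) ^ m = (\<integral>\<omega>. X \<omega> ^ (2 * m) \<partial>M)"
    using assms(1) by (simp add: Lp_norm_power power_even_abs flip: power_mult)
  then show ?thesis using assms by (metis power_mono_iff zero_le_power2 less_eq_Suc_le One_nat_def)
qed

lemma Lp_norm_cmult: "0 < p \<Longrightarrow> Lp_norm M p (\<lambda>\<omega>. a * X \<omega>) = \<bar>a\<bar> * Lp_norm M p X"
  by (simp add: Lp_norm_def abs_mult power_mult_distrib real_root_mult real_root_power_cancel)

lemma Lp_norm_power_comp: "0 < k \<Longrightarrow> Lp_norm M p (\<lambda>\<omega>. X \<omega> ^ k) = Lp_norm M (k * p) X ^ k"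
  by (simp add: Lp_norm_def power_abs power_mult real_root_mult_exp real_root_ge_zero)

lemma Lp_norm_eq_0_imp_AE:
  assumes "all_moments M X" "0 < p" "Lp_norm M p X = 0"
  shows "AE \<omega> in M. X \<omega> = 0"
proof -
  have "(\<integral>\<omega>. \<bar>X \<omega>\<bar> ^ p \<partial>M) = 0"
    using Lp_norm_power[OF assms(2), of M X] assms(2,3) by (simp add: power_0_left)
  then have "AE \<omega> in M. \<bar>X \<omega>\<bar> ^ p = 0"
    using all_momentsD(2)[OF assms(1)] by (simp add: integral_nonneg_eq_0_iff_AE)
  then show ?thesis by eventually_elim simp
qed

lemma (in finite_measure) measure_abs_ge_le_Lp_norm:
  assumes X: "all_moments M X" and "0 < p" "0 < t"
  shows "measure M {\<omega> \<in> space M. t \<le> \<bar>X \<omega>\<bar>} \<le> (Lp_norm M p X / t) ^ p"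
proof -
  note [measurable] = all_momentsD(1)[OF X]
  have "measure M {\<omega> \<in> space M. t \<le> \<bar>X \<omega>\<bar>} \<le> measure M {\<omega> \<in> space M. t ^ p \<le> \<bar>X \<omega>\<bar> ^ p}"
  proof (rule finite_measure_mono)
    show "{\<omega> \<in> space M. t \<le> \<bar>X \<omega>\<bar>} \<subseteq> {\<omega> \<in> space M. t ^ p \<le> \<bar>X \<omega>\<bar> ^ p}"
      using assms by (auto intro: power_mono)
  qed measurable
  also have "\<dots> \<le> (\<integral>\<omega>. \<bar>X \<omega>\<bar> ^ p \<partial>M) / t ^ p"
    using all_momentsD(2)[OF X] assms
    by (intro integral_Markov_inequality_measure[where A = "{}"]) auto
  finally show ?thesis using assms by (simp add: power_divide Lp_norm_power)
qed

lemma (in finite_measure) Holder_power: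
  assumes Y: "all_moments M Y" and X: "all_moments M X" and "k \<le> n" "0 < n"
  shows "(\<integral>\<omega>. \<bar>Y \<omega>\<bar> ^ (n - k) * \<bar>X \<omega>\<bar> ^ k \<partial>M) \<le> Lp_norm M n Y ^ (n - k) * Lp_norm M n X ^ k"
proof -
  let ?a = "Lp_norm M n Y" and ?b = "Lp_norm M n X"
  consider "k = 0" | "k = n" | "0 < k" "k < n" "?a = 0 \<or> ?b = 0" | "0 < k" "k < n" "0 < ?a" "0 < ?b"
    using assms(3) Lp_norm_nonneg[of M n Y] Lp_norm_nonneg[of M n X] by linarith
  then show ?thesis
  proof cases
    case 3
    then have "AE \<omega> in M. Y \<omega> = 0 \<or> X \<omega> = 0"
      using Lp_norm_eq_0_imp_AE[OF Y assms(4)] Lp_norm_eq_0_imp_AE[OF X assms(4)] by auto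
    then have "AE \<omega> in M. \<bar>Y \<omega>\<bar> ^ (n - k) * \<bar>X \<omega>\<bar> ^ k = 0"
      by eventually_elim (use 3 in auto)
    then show ?thesis
      by (subst integral_eq_zero_AE) (auto simp: Lp_norm_nonneg)
  next
    case 4
    have young: "\<bar>Y \<omega>\<bar> ^ (n - k) * \<bar>X \<omega>\<bar> ^ k \<le> ?a ^ (n - k) * ?b ^ k *
        ((real (n - k) / ?a ^ n * \<bar>Y \<omega>\<bar> ^ n + real k / ?b ^ n * \<bar>X \<omega>\<bar> ^ n) / real n)" for \<omega>
      using power_mult_power_le_weighted_sum[of "\<bar>Y \<omega>\<bar> / ?a" "\<bar>X \<omega>\<bar> / ?b" k n] 4
      by (simp add: power_divide divide_le_eq mult_ac)
    have "(\<integral>\<omega>. \<bar>Y \<omega>\<bar> ^ (n - k) * \<bar>X \<omega>\<bar> ^ k \<partial>M) \<le> (\<integral>\<omega>. ?a ^ (n - k) * ?b ^ k *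
        ((real (n - k) / ?a ^ n * \<bar>Y \<omega>\<bar> ^ n + real k / ?b ^ n * \<bar>X \<omega>\<bar> ^ n) / real n) \<partial>M)"
      using young by (intro integral_mono all_momentsD(3)[OF all_moments_mult]
          integrable_mult_right integrable_divide Bochner_Integration.integrable_add
          all_moments_intros X Y all_momentsD(2))
    also have "\<dots> = ?a ^ (n - k) * ?b ^ k *
        ((real (n - k) / ?a ^ n * ?a ^ n + real k / ?b ^ n * ?b ^ n) / real n)"
      using all_momentsD(2)[OF X] all_momentsD(2)[OF Y] assms(4) by (simp add: Lp_norm_power)
    also have "\<dots> = ?a ^ (n - k) * ?b ^ k" using 4 assms(3,4) by (simp add: of_nat_diff)
    finally show ?thesis .
  qed (use assms in \<open>auto simp: Lp_norm_power\<close>)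
qed

lemma (in finite_measure) integral_power_mult_power_le:
  assumes Y: "all_moments M Y" and X: "all_moments M X" and "k \<le> n" "0 < n"
  shows "(\<integral>\<omega>. X \<omega> ^ k * Y \<omega> ^ (n - k) \<partial>M) \<le> Lp_norm M n X ^ k * Lp_norm M n Y ^ (n - k)"
proof -
  have "(\<integral>\<omega>. X \<omega> ^ k * Y \<omega> ^ (n - k) \<partial>M) \<le> (\<integral>\<omega>. \<bar>Y \<omega>\<bar> ^ (n - k) * \<bar>X \<omega>\<bar> ^ k \<partial>M)"
  proof (intro integral_mono all_momentsD(3) all_moments_intros X Y)
    fix \<omega>
    show "X \<omega> ^ k * Y \<omega> ^ (n - k) \<le> \<bar>Y \<omega>\<bar> ^ (n - k) * \<bar>X \<omega>\<bar> ^ k"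
      using abs_ge_self[of "X \<omega> ^ k * Y \<omega> ^ (n - k)"] by (simp add: abs_mult power_abs mult.commute)
  qed
  also have "\<dots> \<le> Lp_norm M n Y ^ (n - k) * Lp_norm M n X ^ k"
    by (rule Holder_power) fact+
  finally show ?thesis by (simp add: mult.commute)
qed

lemma (in finite_measure) integral_power_add_le:
  assumes X: "all_moments M X" and T: "all_moments M T" and m: "1 \<le> m"
  shows "(\<integral>\<omega>. (X \<omega> + T \<omega>) ^ (2 * m) \<partial>M)
    \<le> ((Lp_norm M (2 * m) T)\<^sup>2 + 8 * real m * (Lp_norm M (2 * m) X)\<^sup>2) ^ m
      + 2 * real m * (\<integral>\<omega>. X \<omega> * T \<omega> ^ (2 * m - 1) \<partial>M)"
proof -
  let ?I = "\<lambda>k. \<integral>\<omega>. X \<omega> ^ k * T \<omega> ^ (2 * m - k) \<partial>M"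
  let ?a = "Lp_norm M (2 * m) T" and ?b = "Lp_norm M (2 * m) X"
  let ?J = "\<lambda>k. ?b ^ k * ?a ^ (2 * m - k)"
  have int: "integrable M (\<lambda>\<omega>. X \<omega> ^ k * T \<omega> ^ (2 * m - k))" for k
    by (intro all_momentsD(3) all_moments_intros X T)
  have "(\<integral>\<omega>. (X \<omega> + T \<omega>) ^ (2 * m) \<partial>M) = (\<Sum>k\<le>2 * m. real (2 * m choose k) * ?I k)"
    by (simp add: binomial_ring mult.assoc int)
  also have "\<dots> = real (2 * m) * ?I 1 + (\<Sum>k\<in>{..2 * m} - {1}. real (2 * m choose k) * ?I k)"
    using m by (subst sum.remove[of _ 1]) auto
  also have "\<dots> \<le> real (2 * m) * ?I 1 + (\<Sum>k\<in>{..2 * m} - {1}. real (2 * m choose k) * ?J k)"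
    using m by (intro add_left_mono sum_mono mult_left_mono integral_power_mult_power_le X T) auto
  also have "(\<Sum>k\<in>{..2 * m} - {1}. real (2 * m choose k) * ?J k)
      = (\<Sum>k\<le>2 * m. real (2 * m choose k) * ?J k) - 2 * real m * ?a ^ (2 * m - 1) * ?b"
    using m by (subst (2) sum.remove[of _ 1]) auto
  also have "(\<Sum>k\<le>2 * m. real (2 * m choose k) * ?J k) = (?a + ?b) ^ (2 * m)"
    unfolding add.commute[of ?a] by (simp add: binomial_ring mult.assoc)
  finally show ?thesis
    using power_add_le_shifted_square[OF Lp_norm_nonneg[of M "2 * m" T]
        Lp_norm_nonneg[of M "2 * m" X] m]
    by simp
qed

lemma (in finite_measure) integral_abs_mult_even_power_le:
  assumes Z: "all_moments M Z" and U: "all_moments M U" and m: "1 \<le> m"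
  shows "(\<integral>\<omega>. \<bar>Z \<omega>\<bar> * \<bar>U \<omega>\<bar> ^ (2 * m - 2) \<partial>M) \<le> Lp_norm M m Z * Lp_norm M (2 * m) U ^ (2 * m - 2)"
proof -
  have exponent: "2 * m - 2 = 2 * (m - 1)" by simp
  show ?thesis
    using Holder_power[OF all_moments_power[OF U, of 2] Z m] m
    unfolding exponent power_mult by (simp add: Lp_norm_power_comp mult.commute)
qed

lemma (in finite_measure) abs_integral_mult_geometric_sum_le:
  assumes Z: "all_moments M Z" and U: "all_moments M U" and V: "all_moments M V" and m: "1 \<le> m"
    and norms: "Lp_norm M (2 * m) U \<le> \<alpha>" "Lp_norm M (2 * m) V \<le> \<alpha>"
  shows "\<bar>\<integral>\<omega>. Z \<omega> * (\<Sum>i<2 * m - 1. U \<omega> ^ (2 * m - 1 - Suc i) * V \<omega> ^ i) \<partial>M\<bar>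
    \<le> 4 * real m * Lp_norm M m Z * \<alpha> ^ (2 * m - 2)"
proof -
  define n where "n = 2 * m - 1"
  have n: "2 * m - 2 = n - 1" "real n \<le> 2 * real m" by (auto simp: n_def)
  have abs_integral_le: "(\<integral>\<omega>. \<bar>Z \<omega>\<bar> * \<bar>T \<omega>\<bar> ^ (n - 1) \<partial>M) \<le> Lp_norm M m Z * \<alpha> ^ (n - 1)"
    if "all_moments M T" "Lp_norm M (2 * m) T \<le> \<alpha>" for T
    using integral_abs_mult_even_power_le[OF Z that(1) m] that(2) unfolding n(1)
    by (rule order_trans[OF _ mult_left_mono[OF power_mono]]) (auto simp: Lp_norm_nonneg)
  have "\<bar>\<integral>\<omega>. Z \<omega> * (\<Sum>i<n. U \<omega> ^ (n - Suc i) * V \<omega> ^ i) \<partial>M\<bar>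
      \<le> (\<integral>\<omega>. \<bar>Z \<omega> * (\<Sum>i<n. U \<omega> ^ (n - Suc i) * V \<omega> ^ i)\<bar> \<partial>M)"
    by (rule integral_abs_bound)
  also have "\<dots> \<le> (\<integral>\<omega>. real n * (\<bar>Z \<omega>\<bar> * \<bar>U \<omega>\<bar> ^ (n - 1) + \<bar>Z \<omega>\<bar> * \<bar>V \<omega>\<bar> ^ (n - 1)) \<partial>M)"
  proof (intro integral_mono all_momentsD(3) all_moments_intros Z U V)
    fix \<omega>
    show "\<bar>Z \<omega> * (\<Sum>i<n. U \<omega> ^ (n - Suc i) * V \<omega> ^ i)\<bar>
        \<le> real n * (\<bar>Z \<omega>\<bar> * \<bar>U \<omega>\<bar> ^ (n - 1) + \<bar>Z \<omega>\<bar> * \<bar>V \<omega>\<bar> ^ (n - 1))"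
      using mult_left_mono[OF abs_sum_power_mult_power_le[of "U \<omega>" n "V \<omega>"], of "\<bar>Z \<omega>\<bar>"]
      by (simp add: abs_mult algebra_simps)
  qed
  also have "\<dots> = real n * ((\<integral>\<omega>. \<bar>Z \<omega>\<bar> * \<bar>U \<omega>\<bar> ^ (n - 1) \<partial>M) + (\<integral>\<omega>. \<bar>Z \<omega>\<bar> * \<bar>V \<omega>\<bar> ^ (n - 1) \<partial>M))"
    by (subst integral_mult_right_zero, subst Bochner_Integration.integral_add)
       (auto intro!: all_momentsD(3) all_moments_intros Z U V)
  also have "\<dots> \<le> 2 * real m * (Lp_norm M m Z * \<alpha> ^ (n - 1) + Lp_norm M m Z * \<alpha> ^ (n - 1))"
    using n(2) norms by (intro mult_mono add_mono abs_integral_le U V) auto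
  finally show ?thesis unfolding n(1) by (simp add: n_def mult_ac)
qed

subsection \<open>Lexicographic order and sigma-algebras of a random field\<close>

lemma transp_lex_less: "transp lex_less"
proof (rule transpI)
  fix i j k :: "(int, 'd::{finite,linorder}) vec"
  assume "lex_less i j" "lex_less j k"
  then obtain p r where p: "i $ p < j $ p" "\<forall>q<p. i $ q = j $ q"
    and r: "j $ r < k $ r" "\<forall>q<r. j $ q = k $ q" by (auto simp: lex_less_def)
  have "i $ min p r < k $ min p r \<and> (\<forall>q<min p r. i $ q = k $ q)"
    using p r by (cases p r rule: linorder_cases) (auto simp: min_def)
  then show "lex_less i k" unfolding lex_less_def by blast
qed

lemma totalp_lex_less: "totalp lex_less"
proof (rule totalpI)
  fix i j :: "(int, 'd::{finite,linorder}) vec"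
  assume "i \<noteq> j"
  then have "{p. i $ p \<noteq> j $ p} \<noteq> {}" by (auto simp: vec_eq_iff)
  then obtain p where "i $ p \<noteq> j $ p" "\<forall>q<p. i $ q = j $ q"
    using ex_min_if_finite[of "{p. i $ p \<noteq> j $ p}"] by auto
  then show "lex_less i j \<or> lex_less j i"
    unfolding lex_less_def by (cases "i $ p" "j $ p" rule: linorder_cases) auto
qed

lemma exists_lex_greatest:
  assumes "finite G" "G \<noteq> {}"
  obtains i where "i \<in> G" "\<And>j. j \<in> G - {i} \<Longrightarrow> lex_less j i"
proof -
  have "transp_on G lex_less" "totalp_on G lex_less"
    using transp_lex_less totalp_lex_less by (auto intro: transp_on_subset totalp_on_subset)
  from Finite_Set.bex_greatest_element[OF assms this] show thesis using that by blast
qed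

lemma idist_commute: "idist i j = idist j i"
  by (simp add: idist_def abs_minus_commute)

lemma one_le_idist:
  assumes "i \<noteq> j"
  shows "1 \<le> idist i j"
proof -
  obtain l where "i $ l \<noteq> j $ l" using assms by (auto simp: vec_eq_iff)
  then have "1 \<le> \<bar>i $ l - j $ l\<bar>" by simp
  also have "\<dots> \<le> idist i j" unfolding idist_def by (intro Max_ge) auto
  finally show ?thesis .
qed

lemma mem_Vset_1_iff: "j \<in> Vset 1 i \<longleftrightarrow> lex_less j i"
  using one_le_idist[of i j] by (auto simp: Vset_def lex_less_def)

lemma subalgebra_field_sigma:
  assumes "\<And>j. eps j \<in> borel_measurable M"
  shows "subalgebra M (field_sigma M eps G)"
proof -
  let ?A = "{eps j -` A \<inter> space M | j A. j \<in> G \<and> A \<in> sets borel}"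
  have "?A \<subseteq> sets M" using assms by (auto intro: measurable_sets)
  then show ?thesis
    unfolding subalgebra_def field_sigma_def
    by (auto simp: space_measure_of_conv sets_measure_of_conv dest: sets.sets_into_space
        intro: sets.sigma_sets_subset[THEN subsetD])
qed

lemma measurable_field_sigma:
  assumes "j \<in> G"
  shows "eps j \<in> borel_measurable (field_sigma M eps G)"
proof (rule measurableI)
  fix A :: "real set" assume "A \<in> sets borel"
  then show "eps j -` A \<inter> space (field_sigma M eps G) \<in> sets (field_sigma M eps G)"
    unfolding field_sigma_def
    by (subst sets_measure_of)
       (use assms in \<open>auto simp: space_measure_of_conv intro!: sigma_sets.Basic\<close>)
qed simp

subsection \<open>Weighted sums over a stationary field\<close>

definition weighted_sum :: "('i \<Rightarrow> real) \<Rightarrow> ('i \<Rightarrow> 'a \<Rightarrow> real) \<Rightarrow> 'i set \<Rightarrow> 'a \<Rightarrow> real" where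
  "weighted_sum w eps A \<omega> = (\<Sum>j\<in>A. w j * eps j \<omega>)"

lemma (in finite_measure) all_moments_weighted_sum:
  "(\<And>j. j \<in> A \<Longrightarrow> all_moments M (eps j)) \<Longrightarrow> all_moments M (weighted_sum w eps A)"
  unfolding weighted_sum_def[abs_def] by (intro all_moments_intros)

lemma measurable_weighted_sum_field_sigma:
  "A \<subseteq> G \<Longrightarrow> weighted_sum w eps A \<in> borel_measurable (field_sigma M eps G)"
  unfolding weighted_sum_def[abs_def]
  by (intro borel_measurable_sum borel_measurable_times borel_measurable_const
      measurable_field_sigma) auto

locale stationary_field = prob_space M
  for M :: "'a measure" +
  fixes eps :: "(int, 'd::finite) vec \<Rightarrow> 'a \<Rightarrow> real"
  assumes eps_measurable [measurable]: "\<And>j. eps j \<in> borel_measurable M"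
    and stationary: "strictly_stationary M eps"
begin

lemma distr_weighted_sum_shift:
  assumes "finite A"
  shows "distr M borel (weighted_sum w eps A) = distr M borel (weighted_sum w (\<lambda>j. eps (j + k)) A)"
proof -
  obtain l where l: "set l = A" "distinct l" using finite_distinct_list[OF assms] by blast
  let ?P = "PiM {..<length l} (\<lambda>_. borel :: real measure)"
  define \<Phi> where "\<Phi> v = (\<Sum>m<length l. w (l ! m) * v m)" for v
  have [measurable]: "\<Phi> \<in> borel_measurable ?P" unfolding \<Phi>_def by measurable
  have reindex: "(\<Sum>j\<in>A. f j) = (\<Sum>m<length l. f (l ! m))" for f :: "_ \<Rightarrow> real"
    using sum.reindex_bij_betw[OF bij_betw_nth[OF l(2) refl refl], of f] l(1) by simp
  have "distr (distr M ?P (\<lambda>\<omega>. \<lambda>m\<in>{..<length l}. eps (l ! m) \<omega>)) borel \<Phi>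
      = distr (distr M ?P (\<lambda>\<omega>. \<lambda>m\<in>{..<length l}. eps (l ! m + k) \<omega>)) borel \<Phi>"
    using stationary unfolding strictly_stationary_def by metis
  then have "distr M borel (\<lambda>\<omega>. \<Phi> (\<lambda>m\<in>{..<length l}. eps (l ! m) \<omega>))
      = distr M borel (\<lambda>\<omega>. \<Phi> (\<lambda>m\<in>{..<length l}. eps (l ! m + k) \<omega>))"
    by (subst (asm) (1 2) distr_distr) (auto simp: comp_def)
  then show ?thesis by (simp add: reindex \<Phi>_def weighted_sum_def[abs_def])
qed

lemma distr_eps: "distr M borel (eps j) = distr M borel (eps 0)"
  using distr_weighted_sum_shift[of "{0}" "\<lambda>_. 1" j] by (simp add: weighted_sum_def[abs_def])

lemma integral_eps: "(\<integral>\<omega>. eps j \<omega> \<partial>M) = (\<integral>\<omega>. eps 0 \<omega> \<partial>M)"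
proof -
  have "(\<integral>x. x \<partial>distr M borel (eps j)) = (\<integral>x. x \<partial>distr M borel (eps 0))" by (simp only: distr_eps[of j])
  then show ?thesis by (simp add: integral_distr)
qed

lemma all_moments_eps:
  assumes "all_moments M (eps 0)"
  shows "all_moments M (eps j)"
proof -
  have "integrable M (\<lambda>\<omega>. \<bar>eps j \<omega>\<bar> ^ n)" for n
  proof -
    have "integrable (distr M borel (eps 0)) (\<lambda>x. \<bar>x\<bar> ^ n)"
      using all_momentsD(2)[OF assms] by (simp add: integrable_distr_eq)
    then show ?thesis unfolding distr_eps[of j, symmetric] by (simp add: integrable_distr_eq)
  qed
  then show ?thesis by (simp add: all_moments_def)
qed

lemma Lp_norm_weighted_sum_shift:
  assumes "finite A"
  shows "Lp_norm M p (weighted_sum w eps ((\<lambda>j. j + k) ` A))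
    = Lp_norm M p (weighted_sum (\<lambda>j. w (j + k)) eps A)"
proof -
  have [measurable]: "weighted_sum v (\<lambda>j. eps (f j)) B \<in> borel_measurable M" for v f B
    unfolding weighted_sum_def by measurable
  let ?v = "\<lambda>j. w (j + k)"
  have "(\<integral>x. \<bar>x\<bar> ^ p \<partial>distr M borel (weighted_sum ?v eps A))
      = (\<integral>x. \<bar>x\<bar> ^ p \<partial>distr M borel (weighted_sum ?v (\<lambda>j. eps (j + k)) A))"
    by (simp only: distr_weighted_sum_shift[OF assms, of ?v k])
  then have "Lp_norm M p (weighted_sum ?v eps A) = Lp_norm M p (weighted_sum ?v (\<lambda>j. eps (j + k)) A)"
    by (simp add: Lp_norm_def integral_distr)
  also have "weighted_sum ?v (\<lambda>j. eps (j + k)) A = weighted_sum w eps ((\<lambda>j. j + k) ` A)"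
    by (simp add: weighted_sum_def fun_eq_iff sum.reindex inj_on_def)
  finally show ?thesis ..
qed

end

subsection \<open>Dedecker's moment inequality\<close>

locale stationary_field_moments = stationary_field M eps
  for M :: "'a measure" and eps :: "(int, 'd::{finite,linorder}) vec \<Rightarrow> 'a \<Rightarrow> real" +
  assumes all_moments_eps_0: "all_moments M (eps 0)"
begin

abbreviation past :: "(int, 'd) vec \<Rightarrow> 'a measure" where
  "past k \<equiv> field_sigma M eps (Vset (idist k 0) 0)"

definition lag_product :: "(int, 'd) vec \<Rightarrow> 'a \<Rightarrow> real" where
  "lag_product k \<omega> = eps k \<omega> * real_cond_exp M (past k) (eps 0) \<omega>"

lemma finite_measure_subalgebra_past: "finite_measure_subalgebra M (past k)"
  by unfold_locales (rule subalgebra_field_sigma[OF eps_measurable])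

lemma all_moments_field: "all_moments M (eps j)"
  using all_moments_eps_0 by (rule all_moments_eps)

lemma all_moments_lag_product: "all_moments M (lag_product k)"
proof -
  interpret finite_measure_subalgebra M "past k" by (rule finite_measure_subalgebra_past)
  show ?thesis
    unfolding lag_product_def[abs_def]
    by (intro all_moments_mult all_moments_field all_moments_real_cond_exp)
qed

lemma all_moments_partial_sum: "all_moments M (weighted_sum w eps A)"
  by (intro all_moments_weighted_sum all_moments_field)

lemma integral_eps_mult_eq_lag_product:
  assumes j: "j \<in> Vset 1 0" and G: "all_moments M G" and [measurable]: "G \<in> borel_measurable (past j)"
  shows "(\<integral>\<omega>. eps 0 \<omega> * (eps j \<omega> * G \<omega>) \<partial>M) = (\<integral>\<omega>. lag_product j \<omega> * G \<omega> \<partial>M)"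
proof -
  interpret finite_measure_subalgebra M "past j" by (rule finite_measure_subalgebra_past)
  have "j \<in> Vset (idist j 0) 0" using j by (simp add: Vset_def idist_commute)
  note [measurable] = measurable_field_sigma[OF this, of eps M]
  have "(\<integral>\<omega>. (eps j \<omega> * G \<omega>) * real_cond_exp M (past j) (eps 0) \<omega> \<partial>M)
      = (\<integral>\<omega>. (eps j \<omega> * G \<omega>) * eps 0 \<omega> \<partial>M)"
    by (intro real_cond_exp_intg all_momentsD(3) all_moments_intros all_moments_field G) auto
  then show ?thesis by (simp add: lag_product_def mult_ac)
qed

lemma abs_integral_eps_mult_increment_le:
  assumes m: "1 \<le> m" and j: "j \<in> Vset 1 0" "j \<notin> A" and A: "finite A" "A \<subseteq> Vset (idist j 0) 0"
    and norms: "Lp_norm M (2 * m) (weighted_sum w eps A) \<le> \<alpha>"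
      "Lp_norm M (2 * m) (weighted_sum w eps (insert j A)) \<le> \<alpha>"
  shows "\<bar>(\<integral>\<omega>. eps 0 \<omega> * weighted_sum w eps (insert j A) \<omega> ^ (2 * m - 1) \<partial>M)
      - (\<integral>\<omega>. eps 0 \<omega> * weighted_sum w eps A \<omega> ^ (2 * m - 1) \<partial>M)\<bar>
    \<le> 4 * real m * (\<bar>w j\<bar> * Lp_norm M m (lag_product j)) * \<alpha> ^ (2 * m - 2)"
proof -
  define n where "n = 2 * m - 1"
  define S where "S = weighted_sum w eps A"
  define T where "T = weighted_sum w eps (insert j A)"
  define G where "G \<omega> = (\<Sum>i<n. S \<omega> ^ (n - Suc i) * T \<omega> ^ i)" for \<omega>
  have moments: "all_moments M S" "all_moments M T" "all_moments M G"
    unfolding S_def T_def G_def[abs_def] by (intro all_moments_intros all_moments_partial_sum)+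
  have "insert j A \<subseteq> Vset (idist j 0) 0" using j(1) A(2) by (simp add: Vset_def idist_commute)
  then have [measurable]: "S \<in> borel_measurable (past j)" "T \<in> borel_measurable (past j)"
    unfolding S_def T_def by (auto intro!: measurable_weighted_sum_field_sigma)
  have increment: "T \<omega> ^ n - S \<omega> ^ n = w j * eps j \<omega> * G \<omega>" for \<omega>
    using power_diff_sumr2[of "T \<omega>" n "S \<omega>"] A(1) j(2)
    by (simp add: G_def S_def T_def weighted_sum_def algebra_simps)
  have "(\<integral>\<omega>. eps 0 \<omega> * T \<omega> ^ n \<partial>M) - (\<integral>\<omega>. eps 0 \<omega> * S \<omega> ^ n \<partial>M)
      = (\<integral>\<omega>. eps 0 \<omega> * T \<omega> ^ n - eps 0 \<omega> * S \<omega> ^ n \<partial>M)"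
    by (intro Bochner_Integration.integral_diff[symmetric] all_momentsD(3) all_moments_intros
        all_moments_field moments)
  also have "\<dots> = w j * (\<integral>\<omega>. eps 0 \<omega> * (eps j \<omega> * G \<omega>) \<partial>M)"
    by (simp add: increment mult.left_commute[of "eps 0 _"] mult.assoc flip: right_diff_distrib)
  also have "(\<integral>\<omega>. eps 0 \<omega> * (eps j \<omega> * G \<omega>) \<partial>M) = (\<integral>\<omega>. lag_product j \<omega> * G \<omega> \<partial>M)"
    using j(1) moments(3) by (rule integral_eps_mult_eq_lag_product) (simp add: G_def[abs_def])
  finally have "(\<integral>\<omega>. eps 0 \<omega> * T \<omega> ^ n \<partial>M) - (\<integral>\<omega>. eps 0 \<omega> * S \<omega> ^ n \<partial>M)
      = w j * (\<integral>\<omega>. lag_product j \<omega> * G \<omega> \<partial>M)" .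
  moreover have "\<bar>w j\<bar> * \<bar>\<integral>\<omega>. lag_product j \<omega> * G \<omega> \<partial>M\<bar>
      \<le> \<bar>w j\<bar> * (4 * real m * Lp_norm M m (lag_product j) * \<alpha> ^ (2 * m - 2))"
    unfolding G_def n_def using m norms moments
    by (intro mult_left_mono abs_integral_mult_geometric_sum_le all_moments_lag_product)
       (simp_all add: S_def T_def)
  ultimately show ?thesis
    by (simp add: S_def T_def n_def abs_mult mult_ac)
qed

text \<open>The sites are added in the order of decreasing distance to the origin, so that the increment
  due to \<open>j\<close> is measurable with respect to the sites at distance at least \<open>\<bar>j\<bar>\<close>.\<close>
lemma abs_integral_eps_mult_power_le:
  assumes m: "1 \<le> m" and A: "finite A" "A \<subseteq> Vset 1 0"
    and norms: "\<And>B. B \<subseteq> A \<Longrightarrow> Lp_norm M (2 * m) (weighted_sum w eps B) \<le> \<alpha>"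
  shows "\<bar>\<integral>\<omega>. eps 0 \<omega> * weighted_sum w eps A \<omega> ^ (2 * m - 1) \<partial>M\<bar>
    \<le> 4 * real m * (\<Sum>j\<in>A. \<bar>w j\<bar> * Lp_norm M m (lag_product j)) * \<alpha> ^ (2 * m - 2)"
  using A norms
proof (induction A rule: finite_ranking_induct[where f = "\<lambda>j. - idist j 0"])
  case empty
  then show ?case using m by (simp add: weighted_sum_def power_0_left)
next
  case (insert j A)
  show ?case
  proof (cases "j \<in> A")
    case True
    then show ?thesis using insert by (simp add: insert_absorb)
  next
    case False
    have "A \<subseteq> Vset (idist j 0) 0"
      using insert.hyps insert.prems(1) by (fastforce simp: Vset_def idist_commute)
    then have "\<bar>(\<integral>\<omega>. eps 0 \<omega> * weighted_sum w eps (insert j A) \<omega> ^ (2 * m - 1) \<partial>M)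
        - (\<integral>\<omega>. eps 0 \<omega> * weighted_sum w eps A \<omega> ^ (2 * m - 1) \<partial>M)\<bar>
        \<le> 4 * real m * (\<bar>w j\<bar> * Lp_norm M m (lag_product j)) * \<alpha> ^ (2 * m - 2)"
      using m False insert.hyps(1) insert.prems
      by (intro abs_integral_eps_mult_increment_le) auto
    moreover have "\<bar>\<integral>\<omega>. eps 0 \<omega> * weighted_sum w eps A \<omega> ^ (2 * m - 1) \<partial>M\<bar>
        \<le> 4 * real m * (\<Sum>j\<in>A. \<bar>w j\<bar> * Lp_norm M m (lag_product j)) * \<alpha> ^ (2 * m - 2)"
      using insert.prems by (intro insert.IH) auto
    ultimately show ?thesis
      unfolding sum.insert[OF insert.hyps(1) False] distrib_left distrib_right by linarith
  qed
qed

lemma integral_eps_0_mult_power_le: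
  assumes m: "1 \<le> m" and A: "finite A" "A \<subseteq> Vset 1 0"
    and norms: "\<And>B. B \<subseteq> A \<Longrightarrow> (Lp_norm M (2 * m) (weighted_sum w eps B))\<^sup>2 \<le> a"
  shows "(\<integral>\<omega>. v * eps 0 \<omega> * weighted_sum w eps A \<omega> ^ (2 * m - 1) \<partial>M)
    \<le> 4 * real m * (\<bar>v\<bar> * (\<Sum>j\<in>A. \<bar>w j\<bar> * Lp_norm M m (lag_product j))) * a ^ (m - 1)"
proof -
  define I where "I = (\<integral>\<omega>. eps 0 \<omega> * weighted_sum w eps A \<omega> ^ (2 * m - 1) \<partial>M)"
  define s where "s = (\<Sum>j\<in>A. \<bar>w j\<bar> * Lp_norm M m (lag_product j))"
  have a: "0 \<le> a" using order_trans[OF zero_le_power2 norms[of "{}"]] by simp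
  have exponent: "2 * m - 2 = 2 * (m - 1)" by simp
  have "\<bar>I\<bar> \<le> 4 * real m * s * sqrt a ^ (2 * m - 2)"
    unfolding I_def s_def using m A norms
    by (intro abs_integral_eps_mult_power_le) (auto intro: real_le_rsqrt)
  also have "sqrt a ^ (2 * m - 2) = a ^ (m - 1)"
    using a by (simp only: exponent power_mult real_sqrt_pow2)
  finally have abs_I: "\<bar>I\<bar> \<le> 4 * real m * s * a ^ (m - 1)" .
  have "(\<integral>\<omega>. v * eps 0 \<omega> * weighted_sum w eps A \<omega> ^ (2 * m - 1) \<partial>M) = v * I"
    by (simp add: I_def mult.assoc)
  also have "\<dots> \<le> \<bar>v\<bar> * \<bar>I\<bar>" using abs_ge_self[of "v * I"] by (simp add: abs_mult)
  also have "\<dots> \<le> \<bar>v\<bar> * (4 * real m * s * a ^ (m - 1))" using abs_I by (rule mult_left_mono) simp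
  finally show ?thesis by (simp add: s_def mult_ac)
qed

lemma Lp_norm_sum_insert_0_le:
  assumes m: "1 \<le> m" and A: "finite A" "A \<subseteq> Vset 1 0"
    and norms: "\<And>B. B \<subseteq> A \<Longrightarrow> (Lp_norm M (2 * m) (weighted_sum w eps B))\<^sup>2 \<le> a"
  shows "(Lp_norm M (2 * m) (weighted_sum w eps (insert 0 A)))\<^sup>2
    \<le> a + 8 * real m * ((w 0)\<^sup>2 * (Lp_norm M (2 * m) (eps 0))\<^sup>2
      + \<bar>w 0\<bar> * (\<Sum>j\<in>A. \<bar>w j\<bar> * Lp_norm M m (lag_product j)))"
proof -
  let ?S = "weighted_sum w eps A"
  define s where "s = (\<Sum>j\<in>A. \<bar>w j\<bar> * Lp_norm M m (lag_product j))"
  define u where "u = 8 * real m * ((w 0)\<^sup>2 * (Lp_norm M (2 * m) (eps 0))\<^sup>2)"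
  define v where "v = 8 * real m * (\<bar>w 0\<bar> * s)"
  have a: "0 \<le> a" using order_trans[OF zero_le_power2 norms[of "{}"]] by simp
  have nonneg: "0 \<le> u" "0 \<le> v" by (simp_all add: u_def v_def s_def sum_nonneg Lp_norm_nonneg)
  have "2 * real m * (\<integral>\<omega>. w 0 * eps 0 \<omega> * ?S \<omega> ^ (2 * m - 1) \<partial>M)
      \<le> 2 * real m * (4 * real m * (\<bar>w 0\<bar> * s) * a ^ (m - 1))"
    unfolding s_def by (intro mult_left_mono integral_eps_0_mult_power_le m A norms) auto
  then have cross: "2 * real m * (\<integral>\<omega>. w 0 * eps 0 \<omega> * ?S \<omega> ^ (2 * m - 1) \<partial>M)
      \<le> real m * v * a ^ (m - 1)"
    by (simp add: v_def mult_ac)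
  have "0 \<notin> A" using A(2) by (auto simp: mem_Vset_1_iff lex_less_def)
  then have "weighted_sum w eps (insert 0 A) = (\<lambda>\<omega>. w 0 * eps 0 \<omega> + ?S \<omega>)"
    using A(1) by (simp add: weighted_sum_def fun_eq_iff)
  then have "(\<integral>\<omega>. weighted_sum w eps (insert 0 A) \<omega> ^ (2 * m) \<partial>M)
      = (\<integral>\<omega>. (w 0 * eps 0 \<omega> + ?S \<omega>) ^ (2 * m) \<partial>M)" by simp
  also have "\<dots> \<le> ((Lp_norm M (2 * m) ?S)\<^sup>2 + 8 * real m * (Lp_norm M (2 * m) (\<lambda>\<omega>. w 0 * eps 0 \<omega>))\<^sup>2) ^ m
        + 2 * real m * (\<integral>\<omega>. w 0 * eps 0 \<omega> * ?S \<omega> ^ (2 * m - 1) \<partial>M)"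
    by (intro integral_power_add_le all_moments_intros all_moments_field all_moments_partial_sum m)
  also have "8 * real m * (Lp_norm M (2 * m) (\<lambda>\<omega>. w 0 * eps 0 \<omega>))\<^sup>2 = u"
    using m by (simp add: u_def Lp_norm_cmult power_mult_distrib)
  also have "((Lp_norm M (2 * m) ?S)\<^sup>2 + u) ^ m
        + 2 * real m * (\<integral>\<omega>. w 0 * eps 0 \<omega> * ?S \<omega> ^ (2 * m - 1) \<partial>M)
      \<le> (a + u) ^ m + real m * v * a ^ (m - 1)"
    using norms[of A] nonneg by (intro add_mono power_mono cross) auto
  also have "\<dots> \<le> (a + u) ^ m + real m * v * (a + u) ^ (m - 1)"
    using a nonneg by (intro add_left_mono mult_left_mono power_mono) auto
  also have "\<dots> \<le> (a + u + v) ^ m"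
    using a nonneg by (intro power_add_ge_first_order) auto
  finally show ?thesis
    using m a nonneg by (subst Lp_norm_square_le_iff) (auto simp: u_def v_def s_def algebra_simps)
qed

lemma Lp_norm_sum_insert_lex_greatest_le:
  assumes m: "1 \<le> m" and A: "finite A" "\<And>j. j \<in> A \<Longrightarrow> lex_less j i"
    and norms: "\<And>B. B \<subseteq> A \<Longrightarrow> (Lp_norm M (2 * m) (weighted_sum w eps B))\<^sup>2 \<le> a"
  shows "(Lp_norm M (2 * m) (weighted_sum w eps (insert i A)))\<^sup>2
    \<le> a + 8 * real m * ((w i)\<^sup>2 * (Lp_norm M (2 * m) (eps 0))\<^sup>2
      + \<bar>w i\<bar> * (\<Sum>j\<in>A. \<bar>w j\<bar> * Lp_norm M m (lag_product (j - i))))"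
proof -
  define C where "C = (\<lambda>j. j - i) ` A"
  have C: "finite C" "C \<subseteq> Vset 1 0" "A = (\<lambda>j. j + i) ` C"
    using A by (auto simp: C_def mem_Vset_1_iff lex_less_def image_image)
  have shift: "Lp_norm M (2 * m) (weighted_sum (\<lambda>j. w (j + i)) eps B)
      = Lp_norm M (2 * m) (weighted_sum w eps ((\<lambda>j. j + i) ` B))" if "finite B" for B
    using Lp_norm_weighted_sum_shift[OF that] by simp
  have "(Lp_norm M (2 * m) (weighted_sum (\<lambda>j. w (j + i)) eps B))\<^sup>2 \<le> a" if "B \<subseteq> C" for B
    using norms[of "(\<lambda>j. j + i) ` B"] image_mono[OF that, of "\<lambda>j. j + i"] finite_subset[OF that C(1)]
    unfolding C(3) by (simp only: shift)
  from Lp_norm_sum_insert_0_le[OF m C(1,2) this] show ?thesis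
    using C(1) by (simp add: shift C(3) sum.reindex inj_on_def)
qed

definition dependence_coeff ::
  "nat \<Rightarrow> ((int, 'd) vec \<Rightarrow> real) \<Rightarrow> (int, 'd) vec set \<Rightarrow> (int, 'd) vec \<Rightarrow> real" where
  "dependence_coeff m w \<Gamma> i = (w i)\<^sup>2 * (Lp_norm M (2 * m) (eps 0))\<^sup>2
    + \<bar>w i\<bar> * (\<Sum>j\<in>{j \<in> \<Gamma>. lex_less j i}. \<bar>w j\<bar> * Lp_norm M m (lag_product (j - i)))"

lemma dependence_coeff_nonneg: "0 \<le> dependence_coeff m w \<Gamma> i"
  by (simp add: dependence_coeff_def sum_nonneg Lp_norm_nonneg)

lemma dependence_coeff_mono:
  "finite \<Gamma> \<Longrightarrow> A \<subseteq> \<Gamma> \<Longrightarrow> dependence_coeff m w A i \<le> dependence_coeff m w \<Gamma> i"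
  unfolding dependence_coeff_def
  by (intro add_left_mono mult_left_mono sum_mono2) (auto simp: Lp_norm_nonneg)

theorem Lp_norm_weighted_sum_le:
  assumes m: "1 \<le> m" and "finite \<Gamma>"
  shows "(Lp_norm M (2 * m) (weighted_sum w eps \<Gamma>))\<^sup>2 \<le> 8 * real m * (\<Sum>i\<in>\<Gamma>. dependence_coeff m w \<Gamma> i)"
  using assms(2)
proof (induction \<Gamma> rule: finite_psubset_induct)
  case (psubset \<Gamma>)
  show ?case
  proof (cases "\<Gamma> = {}")
    case True
    then show ?thesis using m by (simp add: weighted_sum_def Lp_norm_def power_0_left)
  next
    case False
    then obtain i where i: "i \<in> \<Gamma>" "\<And>j. j \<in> \<Gamma> - {i} \<Longrightarrow> lex_less j i"
      using exists_lex_greatest psubset.hyps by metis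
    let ?a = "8 * real m * (\<Sum>j\<in>\<Gamma> - {i}. dependence_coeff m w \<Gamma> j)"
    have "(Lp_norm M (2 * m) (weighted_sum w eps B))\<^sup>2 \<le> ?a" if B: "B \<subseteq> \<Gamma> - {i}" for B
    proof -
      have "(Lp_norm M (2 * m) (weighted_sum w eps B))\<^sup>2
          \<le> 8 * real m * (\<Sum>j\<in>B. dependence_coeff m w B j)"
        using B i(1) by (intro psubset.IH) auto
      also have "(\<Sum>j\<in>B. dependence_coeff m w B j) \<le> (\<Sum>j\<in>B. dependence_coeff m w \<Gamma> j)"
        using B psubset.hyps by (intro sum_mono dependence_coeff_mono) auto
      also have "\<dots> \<le> (\<Sum>j\<in>\<Gamma> - {i}. dependence_coeff m w \<Gamma> j)"
        using B psubset.hyps by (intro sum_mono2) (auto simp: dependence_coeff_nonneg)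
      finally show ?thesis by (simp add: mult_left_mono)
    qed
    from Lp_norm_sum_insert_lex_greatest_le[OF m finite_Diff[OF psubset.hyps(1)] i(2) this]
    have "(Lp_norm M (2 * m) (weighted_sum w eps (insert i (\<Gamma> - {i}))))\<^sup>2
        \<le> ?a + 8 * real m * ((w i)\<^sup>2 * (Lp_norm M (2 * m) (eps 0))\<^sup>2
          + \<bar>w i\<bar> * (\<Sum>j\<in>\<Gamma> - {i}. \<bar>w j\<bar> * Lp_norm M m (lag_product (j - i))))" .
    moreover have "\<Gamma> - {i} = {j \<in> \<Gamma>. lex_less j i}" using i(2) by (auto simp: lex_less_def)
    ultimately have "(Lp_norm M (2 * m) (weighted_sum w eps (insert i (\<Gamma> - {i}))))\<^sup>2
        \<le> ?a + 8 * real m * dependence_coeff m w \<Gamma> i" by (simp add: dependence_coeff_def)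
    then show ?thesis
      using i(1) psubset.hyps by (simp add: insert_absorb sum.remove algebra_simps)
  qed
qed

lemma dependence_coeff_le:
  assumes "finite \<Gamma>" "i \<in> \<Gamma>" and w: "\<And>j. j \<in> \<Gamma> \<Longrightarrow> \<bar>w j\<bar> \<le> W"
    and D: "\<And>A. finite A \<Longrightarrow> A \<subseteq> Vset 1 0 \<Longrightarrow>
      (Lp_norm M (2 * m) (eps 0))\<^sup>2 + (\<Sum>k\<in>A. Lp_norm M m (lag_product k)) \<le> D"
  shows "dependence_coeff m w \<Gamma> i \<le> W\<^sup>2 * D"
proof -
  let ?P = "{j \<in> \<Gamma>. lex_less j i}" and ?E = "Lp_norm M (2 * m) (eps 0)"
  have W: "0 \<le> W" using w[OF assms(2)] by linarith
  have "(\<lambda>j. j - i) ` ?P \<subseteq> Vset 1 0" by (auto simp: mem_Vset_1_iff lex_less_def)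
  then have "?E\<^sup>2 + (\<Sum>j\<in>?P. Lp_norm M m (lag_product (j - i))) \<le> D"
    using D[of "(\<lambda>j. j - i) ` ?P"] assms(1) by (simp add: sum.reindex inj_on_def)
  then have "W\<^sup>2 * ?E\<^sup>2 + W * (\<Sum>j\<in>?P. W * Lp_norm M m (lag_product (j - i))) \<le> W\<^sup>2 * D"
    unfolding sum_distrib_left[symmetric]
    using mult_left_mono[of _ D "W\<^sup>2"] by (fastforce simp: power2_eq_square algebra_simps)
  moreover have "dependence_coeff m w \<Gamma> i
      \<le> W\<^sup>2 * ?E\<^sup>2 + W * (\<Sum>j\<in>?P. W * Lp_norm M m (lag_product (j - i)))"
    unfolding dependence_coeff_def using w assms(2) W
    by (intro add_mono mult_mono sum_mono mult_right_mono)
       (auto simp: Lp_norm_nonneg sum_nonneg abs_le_square_iff[symmetric])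
  ultimately show ?thesis by linarith
qed

corollary Lp_norm_weighted_sum_le_card:
  assumes "1 \<le> m" "finite \<Gamma>" and "\<And>j. j \<in> \<Gamma> \<Longrightarrow> \<bar>w j\<bar> \<le> W"
    and "\<And>A. finite A \<Longrightarrow> A \<subseteq> Vset 1 0 \<Longrightarrow>
      (Lp_norm M (2 * m) (eps 0))\<^sup>2 + (\<Sum>k\<in>A. Lp_norm M m (lag_product k)) \<le> D"
  shows "(Lp_norm M (2 * m) (weighted_sum w eps \<Gamma>))\<^sup>2 \<le> 8 * real m * (real (card \<Gamma>) * (W\<^sup>2 * D))"
proof -
  have "(\<Sum>i\<in>\<Gamma>. dependence_coeff m w \<Gamma> i) \<le> real (card \<Gamma>) * (W\<^sup>2 * D)"
    by (intro sum_bounded_above dependence_coeff_le assms)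
  with Lp_norm_weighted_sum_le[OF assms(1,2)] show ?thesis
    by (rule order_trans[OF _ mult_left_mono]) simp
qed

end

subsection \<open>Moment growth under Orlicz conditions\<close>

lemma powr_le_powr_self_mult_exp:
  fixes s t :: real
  assumes "0 < s" "0 < t"
  shows "t powr s \<le> s powr s * exp t"
proof -
  have "ln (t / s) \<le> t / s" using assms ln_le_minus_one[of "t / s"] by simp
  then have "s * ln t \<le> s * ln s + t" using assms by (simp add: ln_div field_simps)
  then have "exp (s * ln t) \<le> exp (s * ln s + t)" by simp
  then show ?thesis using assms by (simp add: powr_def exp_add)
qed

lemma xi_beta_nonneg: "0 \<le> xi_beta \<beta>"
  by (simp add: xi_beta_def)

lemma psi_beta_nonneg: "0 < \<beta> \<Longrightarrow> 0 \<le> x \<Longrightarrow> 0 \<le> psi_beta \<beta> x"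
  using powr_mono2[of \<beta> "xi_beta \<beta>" "x + xi_beta \<beta>"] xi_beta_nonneg[of \<beta>]
  by (simp add: psi_beta_def)

lemma power_le_psi_beta:
  assumes "0 < \<beta>" "0 \<le> x" "1 \<le> p"
  shows "x ^ p \<le> ((real p / \<beta>) powr (1 / \<beta>)) ^ p * (psi_beta \<beta> x + exp (xi_beta \<beta> powr \<beta>))"
proof (cases "x = 0")
  case True
  then show ?thesis using assms psi_beta_nonneg[of \<beta> x] by (simp add: power_0_left)
next
  case False
  then have x: "0 < x" using assms by simp
  have "x ^ p = (x powr \<beta>) powr (real p / \<beta>)"
    using x assms by (simp add: powr_powr powr_realpow)
  also have "\<dots> \<le> (real p / \<beta>) powr (real p / \<beta>) * exp (x powr \<beta>)"
    using x assms by (intro powr_le_powr_self_mult_exp) auto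
  also have "\<dots> \<le> (real p / \<beta>) powr (real p / \<beta>) * exp ((x + xi_beta \<beta>) powr \<beta>)"
    using x assms xi_beta_nonneg[of \<beta>] by (intro mult_left_mono) (auto intro!: powr_mono2)
  also have "(real p / \<beta>) powr (real p / \<beta>) = ((real p / \<beta>) powr (1 / \<beta>)) ^ p"
    using assms by (simp add: powr_powr flip: powr_realpow)
  finally show ?thesis by (simp add: psi_beta_def)
qed

definition orlicz_moment_const :: "real \<Rightarrow> real" where
  "orlicz_moment_const \<beta> = (1 / \<beta>) powr (1 / \<beta>) * (1 + exp (xi_beta \<beta> powr \<beta>))"

lemma orlicz_moment_const_pos: "0 < \<beta> \<Longrightarrow> 0 < orlicz_moment_const \<beta>"
  by (simp add: orlicz_moment_const_def add_pos_pos)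

lemma (in prob_space) nn_integral_power_le_of_psi_beta:
  assumes \<beta>: "0 < \<beta>" and p: "1 \<le> p" and [measurable]: "X \<in> borel_measurable M"
    and psi: "(\<integral>\<^sup>+\<omega>. ennreal (psi_beta \<beta> \<bar>X \<omega>\<bar>) \<partial>M) \<le> 1"
  shows "(\<integral>\<^sup>+\<omega>. ennreal (\<bar>X \<omega>\<bar> ^ p) \<partial>M) \<le> ennreal ((orlicz_moment_const \<beta> * real p powr (1 / \<beta>)) ^ p)"
proof -
  define e where "e = exp (xi_beta \<beta> powr \<beta>)"
  define r where "r = (real p / \<beta>) powr (1 / \<beta>)"
  have pos: "0 < e" "0 < r" using \<beta> p by (auto simp: e_def r_def)
  have [measurable]: "(\<lambda>\<omega>. psi_beta \<beta> \<bar>X \<omega>\<bar>) \<in> borel_measurable M"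
    unfolding psi_beta_def by measurable
  have "(\<integral>\<^sup>+\<omega>. ennreal (\<bar>X \<omega>\<bar> ^ p) \<partial>M)
      \<le> (\<integral>\<^sup>+\<omega>. ennreal (r ^ p) * (ennreal (psi_beta \<beta> \<bar>X \<omega>\<bar>) + ennreal e) \<partial>M)"
  proof (rule nn_integral_mono)
    fix \<omega>
    have "ennreal (\<bar>X \<omega>\<bar> ^ p) \<le> ennreal (r ^ p * (psi_beta \<beta> \<bar>X \<omega>\<bar> + e))"
      unfolding r_def e_def using \<beta> p by (intro ennreal_leI power_le_psi_beta) auto
    also have "\<dots> = ennreal (r ^ p) * (ennreal (psi_beta \<beta> \<bar>X \<omega>\<bar>) + ennreal e)"
      using pos psi_beta_nonneg[OF \<beta>, of "\<bar>X \<omega>\<bar>"] by (simp add: ennreal_mult ennreal_plus)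
    finally show "ennreal (\<bar>X \<omega>\<bar> ^ p) \<le> ennreal (r ^ p) * (ennreal (psi_beta \<beta> \<bar>X \<omega>\<bar>) + ennreal e)" .
  qed
  also have "\<dots> = ennreal (r ^ p) * ((\<integral>\<^sup>+\<omega>. ennreal (psi_beta \<beta> \<bar>X \<omega>\<bar>) \<partial>M) + ennreal e)"
    by (simp add: nn_integral_cmult nn_integral_add emeasure_space_1)
  also have "\<dots> \<le> ennreal (r ^ p) * (1 + ennreal e)"
    using psi by (intro mult_left_mono add_right_mono) auto
  also have "\<dots> = ennreal (r ^ p * (1 + e))"
    using pos by (simp add: ennreal_mult ennreal_plus)
  also have "\<dots> \<le> ennreal ((r * (1 + e)) ^ p)"
    using self_le_power[of "1 + e" p] pos p by (simp add: ennreal_leI power_mult_distrib)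
  also have "r * (1 + e) = orlicz_moment_const \<beta> * real p powr (1 / \<beta>)"
    using \<beta> by (simp add: r_def e_def orlicz_moment_const_def powr_divide)
  finally show ?thesis .
qed

lemma (in prob_space)
  assumes \<beta>: "0 < \<beta>" and c: "0 < c" and [measurable]: "X \<in> borel_measurable M"
    and psi: "(\<integral>\<^sup>+\<omega>. ennreal (psi_beta \<beta> (\<bar>X \<omega>\<bar> / c)) \<partial>M) \<le> 1"
  shows all_moments_of_psi_beta: "all_moments M X"
    and Lp_norm_le_of_psi_beta:
      "1 \<le> p \<Longrightarrow> Lp_norm M p X \<le> orlicz_moment_const \<beta> * real p powr (1 / \<beta>) * c"
proof -
  define Y where "Y \<omega> = X \<omega> / c" for \<omega>
  have [measurable]: "Y \<in> borel_measurable M" unfolding Y_def by measurable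
  have X: "X = (\<lambda>\<omega>. c * Y \<omega>)" using c by (simp add: Y_def)
  have nn_integral_le: "(\<integral>\<^sup>+\<omega>. ennreal (\<bar>Y \<omega>\<bar> ^ p) \<partial>M)
      \<le> ennreal ((orlicz_moment_const \<beta> * real p powr (1 / \<beta>)) ^ p)"
    if "1 \<le> p" for p
    using that \<beta> c psi by (intro nn_integral_power_le_of_psi_beta) (auto simp: Y_def)
  have "integrable M (\<lambda>\<omega>. \<bar>Y \<omega>\<bar> ^ p)" for p
  proof (cases "p = 0")
    case False
    then show ?thesis
      using nn_integral_le[of p] by (intro integrableI_bounded) (auto intro: le_less_trans)
  qed simp
  then have Y: "all_moments M Y" by (simp add: all_moments_def)
  then show "all_moments M X" unfolding X by (intro all_moments_mult all_moments_const)
  assume p: "1 \<le> p"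
  have "(\<integral>\<omega>. \<bar>Y \<omega>\<bar> ^ p \<partial>M) \<le> (orlicz_moment_const \<beta> * real p powr (1 / \<beta>)) ^ p"
    using nn_integral_le[OF p] orlicz_moment_const_pos[OF \<beta>] all_momentsD(2)[OF Y, of p]
    by (subst (asm) nn_integral_eq_integral) (auto simp: ennreal_le_iff)
  then have "Lp_norm M p Y \<le> orlicz_moment_const \<beta> * real p powr (1 / \<beta>)"
    using p orlicz_moment_const_pos[OF \<beta>] by (subst Lp_norm_le_iff) auto
  then have "c * Lp_norm M p Y \<le> c * (orlicz_moment_const \<beta> * real p powr (1 / \<beta>))"
    using c by (intro mult_left_mono) auto
  then show "Lp_norm M p X \<le> orlicz_moment_const \<beta> * real p powr (1 / \<beta>) * c"
    unfolding X using c p by (simp add: Lp_norm_cmult mult_ac)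
qed

lemma (in prob_space) all_moments_of_finite_orlicz_norm:
  assumes "0 < \<beta>" "X \<in> borel_measurable M" "orlicz_norm M \<beta> X < \<infinity>"
  shows "all_moments M X"
  using assms all_moments_of_psi_beta[of \<beta> _ X] unfolding orlicz_norm_def Inf_less_iff by blast

lemma (in prob_space) Lp_norm_le_orlicz_norm:
  assumes "0 < \<beta>" "X \<in> borel_measurable M" "orlicz_norm M \<beta> X < \<infinity>" "1 \<le> p"
  shows "Lp_norm M p X \<le> orlicz_moment_const \<beta> * real p powr (1 / \<beta>) * enn2real (orlicz_norm M \<beta> X)"
proof -
  define a where "a = orlicz_moment_const \<beta> * real p powr (1 / \<beta>)"
  have a: "0 < a" using assms orlicz_moment_const_pos by (simp add: a_def)
  have "ennreal (Lp_norm M p X / a) \<le> orlicz_norm M \<beta> X"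
    unfolding orlicz_norm_def
  proof (rule Inf_greatest, safe)
    fix c :: real
    assume "0 < c" "(\<integral>\<^sup>+\<omega>. ennreal (psi_beta \<beta> (\<bar>X \<omega>\<bar> / c)) \<partial>M) \<le> 1"
    then have "Lp_norm M p X \<le> a * c"
      unfolding a_def using assms by (intro Lp_norm_le_of_psi_beta)
    then show "ennreal (Lp_norm M p X / a) \<le> ennreal c"
      using a by (intro ennreal_leI) (simp add: divide_le_eq mult.commute)
  qed
  then have "Lp_norm M p X / a \<le> enn2real (orlicz_norm M \<beta> X)"
    using assms(3) a by (subst ennreal_le_iff[symmetric]) (auto simp: less_top)
  then show ?thesis using a by (simp add: a_def divide_le_eq mult.commute)
qed

lemma sum_le_nn_integral_count_space:
  assumes "finite A" "A \<subseteq> V"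
  shows "(\<Sum>k\<in>A. f k) \<le> (\<integral>\<^sup>+k. f k \<partial>count_space V)"
proof -
  have "(\<Sum>k\<in>A. f k) = (\<integral>\<^sup>+k. f k * indicator A k \<partial>count_space V)"
    using assms by (subst nn_integral_count_space'[of A]) auto
  also have "\<dots> \<le> (\<integral>\<^sup>+k. f k \<partial>count_space V)"
    by (intro nn_integral_mono) (auto simp: indicator_def)
  finally show ?thesis .
qed

lemma sum_enn2real_le_nn_integral_count_space:
  assumes "finite A" "A \<subseteq> V" "(\<integral>\<^sup>+k. f k \<partial>count_space V) < \<infinity>"
  shows "(\<Sum>k\<in>A. enn2real (f k)) \<le> enn2real (\<integral>\<^sup>+k. f k \<partial>count_space V)"
proof -
  have "f k < \<infinity>" if "k \<in> A" for k
    using nn_integral_ge_point[of k V f] that assms by (auto intro: le_less_trans)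
  then have "(\<Sum>k\<in>A. enn2real (f k)) = enn2real (\<Sum>k\<in>A. f k)"
    by (subst enn2real_sum) auto
  also have "\<dots> \<le> enn2real (\<integral>\<^sup>+k. f k \<partial>count_space V)"
    using assms by (intro enn2real_mono sum_le_nn_integral_count_space) auto
  finally show ?thesis .
qed

definition moment_growth :: "'a measure \<Rightarrow> ('i \<Rightarrow> 'a \<Rightarrow> real) \<Rightarrow> real \<Rightarrow> real \<Rightarrow> bool" where
  "moment_growth M eps \<gamma> L \<longleftrightarrow> (\<forall>i. all_moments M (eps i)) \<and>
    (\<forall>m\<ge>1. \<forall>A w W. finite A \<longrightarrow> (\<forall>i\<in>A. \<bar>w i\<bar> \<le> W) \<longrightarrow>
      Lp_norm M (2 * m) (weighted_sum w eps A) \<le> L * W * sqrt (real (card A)) * real (2 * m) powr \<gamma>)"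

locale orlicz_field = stationary_field M eps
  for M :: "'a measure" and eps :: "(int, 'd::{finite,linorder}) vec \<Rightarrow> 'a \<Rightarrow> real" +
  fixes \<beta> :: real
  assumes \<beta>_pos: "0 < \<beta>"
    and orlicz_norm_eps_0: "orlicz_norm M \<beta> (eps 0) < \<infinity>"
    and orlicz_norms_summable: "(\<integral>\<^sup>+ k. (orlicz_norm M \<beta> (\<lambda>\<omega>. sqrt \<bar>eps k \<omega> *
      real_cond_exp M (field_sigma M eps (Vset (idist k 0) 0)) (eps 0) \<omega>\<bar>)) ^ 2
      \<partial>count_space (Vset 1 0)) < \<infinity>"
begin

sublocale stationary_field_moments M eps
  by unfold_locales (rule all_moments_of_finite_orlicz_norm[OF \<beta>_pos eps_measurable orlicz_norm_eps_0])

definition lag_norm :: "(int, 'd) vec \<Rightarrow> ennreal" where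
  "lag_norm k = orlicz_norm M \<beta> (\<lambda>\<omega>. sqrt \<bar>lag_product k \<omega>\<bar>)"

definition dependence_bound :: real where
  "dependence_bound = (enn2real (orlicz_norm M \<beta> (eps 0)))\<^sup>2
    + enn2real (\<integral>\<^sup>+k. lag_norm k ^ 2 \<partial>count_space (Vset 1 0))"

lemma lag_norms_summable: "(\<integral>\<^sup>+k. lag_norm k ^ 2 \<partial>count_space (Vset 1 0)) < \<infinity>"
  using orlicz_norms_summable by (simp add: lag_norm_def lag_product_def)

lemma sum_lag_norm_le_dependence_bound:
  assumes "finite A" "A \<subseteq> Vset 1 0"
  shows "(enn2real (orlicz_norm M \<beta> (eps 0)))\<^sup>2 + (\<Sum>k\<in>A. (enn2real (lag_norm k))\<^sup>2) \<le> dependence_bound"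
  using sum_enn2real_le_nn_integral_count_space[OF assms lag_norms_summable]
  by (simp add: dependence_bound_def power2_eq_square enn2real_mult)

lemma Lp_norm_lag_product_le:
  assumes "k \<in> Vset 1 0" "1 \<le> m"
  shows "Lp_norm M m (lag_product k)
    \<le> (orlicz_moment_const \<beta> * real (2 * m) powr (1 / \<beta>) * enn2real (lag_norm k))\<^sup>2"
proof -
  let ?r = "\<lambda>\<omega>. sqrt \<bar>lag_product k \<omega>\<bar>"
  have "lag_norm k ^ 2 < \<infinity>"
    using nn_integral_ge_point[OF assms(1), of "\<lambda>k. lag_norm k ^ 2"] lag_norms_summable by auto
  then have finite: "orlicz_norm M \<beta> ?r < \<infinity>"
    unfolding lag_norm_def[symmetric] by (cases "lag_norm k = \<top>") (auto simp: less_top power2_eq_square)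
  have [measurable]: "lag_product k \<in> borel_measurable M"
    by (rule all_momentsD(1)[OF all_moments_lag_product])
  have "Lp_norm M m (lag_product k) = Lp_norm M m (\<lambda>\<omega>. ?r \<omega> ^ 2)"
    by (simp add: Lp_norm_def)
  also have "\<dots> = (Lp_norm M (2 * m) ?r)\<^sup>2" by (rule Lp_norm_power_comp) simp
  also have "\<dots> \<le> (orlicz_moment_const \<beta> * real (2 * m) powr (1 / \<beta>) * enn2real (orlicz_norm M \<beta> ?r))\<^sup>2"
    using assms(2) finite \<beta>_pos by (intro power_mono Lp_norm_le_orlicz_norm Lp_norm_nonneg) auto
  finally show ?thesis by (simp add: lag_norm_def)
qed

lemma Lp_norm_sum_square_le:
  assumes "1 \<le> m" "finite A" "\<And>j. j \<in> A \<Longrightarrow> \<bar>w j\<bar> \<le> W"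
  shows "(Lp_norm M (2 * m) (weighted_sum w eps A))\<^sup>2
    \<le> 8 * real m * (real (card A) * (W\<^sup>2 *
      ((orlicz_moment_const \<beta> * real (2 * m) powr (1 / \<beta>))\<^sup>2 * dependence_bound)))"
proof (rule Lp_norm_weighted_sum_le_card[OF assms])
  fix B :: "(int, 'd) vec set"
  assume B: "finite B" "B \<subseteq> Vset 1 0"
  define a where "a = orlicz_moment_const \<beta> * real (2 * m) powr (1 / \<beta>)"
  have "Lp_norm M (2 * m) (eps 0) \<le> a * enn2real (orlicz_norm M \<beta> (eps 0))"
    unfolding a_def using assms(1) \<beta>_pos orlicz_norm_eps_0 by (intro Lp_norm_le_orlicz_norm) auto
  moreover have "Lp_norm M m (lag_product k) \<le> (a * enn2real (lag_norm k))\<^sup>2" if "k \<in> B" for k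
    unfolding a_def using that B(2) assms(1) by (intro Lp_norm_lag_product_le) auto
  ultimately have "(Lp_norm M (2 * m) (eps 0))\<^sup>2 + (\<Sum>k\<in>B. Lp_norm M m (lag_product k))
      \<le> (a * enn2real (orlicz_norm M \<beta> (eps 0)))\<^sup>2 + (\<Sum>k\<in>B. (a * enn2real (lag_norm k))\<^sup>2)"
    by (intro add_mono sum_mono power_mono Lp_norm_nonneg)
  also have "\<dots> = a\<^sup>2 * ((enn2real (orlicz_norm M \<beta> (eps 0)))\<^sup>2 + (\<Sum>k\<in>B. (enn2real (lag_norm k))\<^sup>2))"
    by (simp add: power_mult_distrib sum_distrib_left distrib_left)
  also have "\<dots> \<le> a\<^sup>2 * dependence_bound"
    using B by (intro mult_left_mono sum_lag_norm_le_dependence_bound) auto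
  finally show "(Lp_norm M (2 * m) (eps 0))\<^sup>2 + (\<Sum>k\<in>B. Lp_norm M m (lag_product k))
      \<le> (orlicz_moment_const \<beta> * real (2 * m) powr (1 / \<beta>))\<^sup>2 * dependence_bound"
    by (simp only: a_def)
qed

theorem moment_growth_field:
  obtains L where "0 < L" "moment_growth M eps (1 / 2 + 1 / \<beta>) L"
proof
  define L where "L = 2 * orlicz_moment_const \<beta> * sqrt (dependence_bound + 1)"
  have bound: "0 \<le> dependence_bound" by (simp add: dependence_bound_def)
  show "0 < L" using bound orlicz_moment_const_pos[OF \<beta>_pos] by (simp add: L_def)
  have "Lp_norm M (2 * m) (weighted_sum w eps A)
      \<le> L * W * sqrt (real (card A)) * real (2 * m) powr (1 / 2 + 1 / \<beta>)"
    if m: "1 \<le> m" and A: "finite A" "\<forall>i\<in>A. \<bar>w i\<bar> \<le> W" for m A w W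
  proof (cases "A = {}")
    case True
    then show ?thesis using m by (simp add: weighted_sum_def Lp_norm_def power_0_left)
  next
    case False
    then have W: "0 \<le> W" using A(2) by (meson abs_ge_zero all_not_in_conv order_trans)
    define r where "r = real (2 * m) powr (1 / \<beta>)"
    have "(Lp_norm M (2 * m) (weighted_sum w eps A))\<^sup>2
        \<le> 8 * real m * (real (card A) * (W\<^sup>2 * ((orlicz_moment_const \<beta> * r)\<^sup>2 * dependence_bound)))"
      unfolding r_def using m A by (intro Lp_norm_sum_square_le) auto
    also have "\<dots> \<le> 8 * real m * (real (card A) *
        (W\<^sup>2 * ((orlicz_moment_const \<beta> * r)\<^sup>2 * (dependence_bound + 1))))"
      by (intro mult_left_mono) auto
    also have "\<dots> = L\<^sup>2 * W\<^sup>2 * real (card A) * (real (2 * m) * r\<^sup>2)"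
      using bound by (simp add: L_def power_mult_distrib)
    also have "\<dots> = (L * W * sqrt (real (card A)) * (sqrt (real (2 * m)) * r))\<^sup>2"
      by (simp add: power_mult_distrib)
    also have "sqrt (real (2 * m)) * r = real (2 * m) powr (1 / 2 + 1 / \<beta>)"
      unfolding r_def powr_add by (simp add: powr_half_sqrt)
    finally show ?thesis
      by (rule power2_le_imp_le) (use W \<open>0 < L\<close> in simp)
  qed
  then show "moment_growth M eps (1 / 2 + 1 / \<beta>) L"
    using all_moments_field unfolding moment_growth_def by blast
qed

end

subsection \<open>Design points in a window\<close>

lemma maxnorm_le_iff: "maxnorm x \<le> a \<longleftrightarrow> (\<forall>k. \<bar>x $ k\<bar> \<le> a)"
  unfolding maxnorm_def by (subst Max_le_iff) auto

lemma
  fixes I :: "'d::finite \<Rightarrow> 'b set"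
  assumes "\<And>k. finite (I k)"
  shows finite_vec_box: "finite {v :: ('b, 'd) vec. \<forall>k. v $ k \<in> I k}"
    and card_vec_box: "card {v :: ('b, 'd) vec. \<forall>k. v $ k \<in> I k} = (\<Prod>k\<in>UNIV. card (I k))"
proof -
  have eq: "{v :: ('b, 'd) vec. \<forall>k. v $ k \<in> I k} = vec_lambda ` (PiE UNIV I)"
  proof (intro subset_antisym subsetI)
    fix v :: "('b, 'd) vec" assume "v \<in> {v. \<forall>k. v $ k \<in> I k}"
    then have "v = vec_lambda (\<lambda>k. v $ k)" "(\<lambda>k. v $ k) \<in> PiE UNIV I" by auto
    then show "v \<in> vec_lambda ` (PiE UNIV I)" by blast
  qed auto
  have inj: "inj_on vec_lambda (PiE UNIV I)" by (auto simp: inj_on_def vec_eq_iff)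
  show "finite {v :: ('b, 'd) vec. \<forall>k. v $ k \<in> I k}"
    unfolding eq using assms by (intro finite_imageI finite_PiE) auto
  show "card {v :: ('b, 'd) vec. \<forall>k. v $ k \<in> I k} = (\<Prod>k\<in>UNIV. card (I k))"
    unfolding eq card_image[OF inj] by (rule card_PiE) simp
qed

lemma Lam_eq: "Lam n = {i. \<forall>k. i $ k \<in> {1..int n}}"
  by (auto simp: Lam_def)

lemma finite_Lam: "finite (Lam n)"
  unfolding Lam_eq by (intro finite_vec_box) simp

lemma card_Lam: "card (Lam n :: (int^'d::finite) set) = n ^ CARD('d)"
  unfolding Lam_eq by (subst card_vec_box) auto

definition window :: "nat \<Rightarrow> real \<Rightarrow> real^'d::finite \<Rightarrow> (int^'d) set" where
  "window n h x = {i \<in> Lam n. maxnorm ((1 / h) *\<^sub>R (x - scaled n i)) \<le> 1}"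

lemma finite_window: "finite (window n h x)"
  unfolding window_def by (rule finite_Collect_conjI) (simp add: finite_Lam)

lemma window_eq:
  assumes "0 < n" "0 < h"
  shows "window n h x = {i. \<forall>k. i $ k \<in>
    {max 1 \<lceil>real n * (x $ k - h)\<rceil> .. min (int n) \<lfloor>real n * (x $ k + h)\<rfloor>}}"
proof -
  have "\<bar>1 / h * (y - real_of_int j / real n)\<bar> \<le> 1 \<longleftrightarrow>
      \<lceil>real n * (y - h)\<rceil> \<le> j \<and> j \<le> \<lfloor>real n * (y + h)\<rfloor>" for y j
    using assms by (simp add: abs_mult abs_le_iff le_floor_iff ceiling_le_iff field_simps)
  then show ?thesis
    by (auto simp: window_def Lam_def maxnorm_le_iff scaled_def)
qed

definition admissible_bandwidth :: "nat \<Rightarrow> real \<Rightarrow> bool" where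
  "admissible_bandwidth n h \<longleftrightarrow> 4 \<le> n \<and> 0 < h \<and> h \<le> 1 \<and> 2 \<le> real n * h"

lemma eventually_admissible_bandwidth:
  assumes "\<And>n. 0 < h n" "h \<longlonglongrightarrow> 0" "filterlim (\<lambda>n. real n * h n) at_top sequentially"
  shows "eventually (\<lambda>n. admissible_bandwidth n (h n)) sequentially"
proof -
  have "eventually (\<lambda>n. h n < 1) sequentially" using assms(2) by (rule order_tendstoD) simp
  moreover have "eventually (\<lambda>n. 2 \<le> real n * h n) sequentially"
    using assms(3) by (simp add: filterlim_at_top)
  ultimately show ?thesis
    using eventually_ge_at_top[of 4]
    by eventually_elim (use assms(1) in \<open>simp add: admissible_bandwidth_def\<close>)
qed

lemma card_grid_interval_ge:
  assumes adm: "admissible_bandwidth n h" and t: "0 \<le> t" "t \<le> 1"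
  shows "real n * h / 2 \<le> real (card {max 1 \<lceil>real n * (t - h)\<rceil> .. min (int n) \<lfloor>real n * (t + h)\<rfloor>})"
proof -
  define l where "l = \<lceil>real n * (t - h)\<rceil>"
  define u where "u = \<lfloor>real n * (t + h)\<rfloor>"
  have l: "real_of_int l \<le> real n * t - real n * h + 1"
    unfolding l_def right_diff_distrib by linarith
  have u: "real n * t + real n * h - 1 \<le> real_of_int u"
    unfolding u_def distrib_left by linarith
  have "0 \<le> real n * t" "real n * t \<le> real n" "real n * h \<le> real n" "2 \<le> real n * h"
    using adm t by (auto simp: admissible_bandwidth_def mult_left_le)
  moreover have "real_of_int (min (int n) u) = min (real n) (real_of_int u)"
    "real_of_int (max 1 l) = max 1 (real_of_int l)" by (auto simp: min_def max_def)
  ultimately have "real n * h / 2 \<le> real_of_int (min (int n) u - max 1 l + 1)"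
    using l u by linarith
  also have "\<dots> \<le> real (card {max 1 l .. min (int n) u})" by simp
  finally show ?thesis by (simp only: l_def u_def)
qed

lemma card_window_ge:
  fixes x :: "real^'d::finite"
  assumes adm: "admissible_bandwidth n h" and x: "x \<in> unit_cube"
  shows "(real n * h / 2) ^ CARD('d) \<le> real (card (window n h x))"
proof -
  let ?I = "\<lambda>k. {max 1 \<lceil>real n * (x $ k - h)\<rceil> .. min (int n) \<lfloor>real n * (x $ k + h)\<rfloor>}"
  have n: "0 < n" "0 < h" using adm by (auto simp: admissible_bandwidth_def)
  have "(\<Prod>k\<in>(UNIV :: 'd set). real n * h / 2) \<le> (\<Prod>k\<in>UNIV. real (card (?I k)))"
    using n x by (intro prod_mono conjI card_grid_interval_ge adm) (auto simp: unit_cube_def)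
  also have "\<dots> = real (card (window n h x))"
    unfolding window_eq[OF n] by (subst card_vec_box) auto
  finally show ?thesis by simp
qed

subsection \<open>Kernel weights\<close>

definition kernel_weight :: "(real^'d::finite \<Rightarrow> real) \<Rightarrow> nat \<Rightarrow> real \<Rightarrow> real^'d \<Rightarrow> int^'d \<Rightarrow> real" where
  "kernel_weight K n h x i =
    K ((1 / h) *\<^sub>R (x - scaled n i)) / (\<Sum>j\<in>Lam n. K ((1 / h) *\<^sub>R (x - scaled n j)))"

lemma (in prob_space) gn_minus_expectation:
  fixes eps :: "int^'d::finite \<Rightarrow> 'a \<Rightarrow> real"
  assumes "\<And>i. integrable M (eps i)" "\<And>i. expectation (eps i) = 0"
  shows "gn eps g K h n x \<omega> - expectation (gn eps g K h n x)
    = weighted_sum (kernel_weight K n (h n) x) eps (Lam n) \<omega>"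
proof -
  define G where "G = (\<Sum>i\<in>Lam n. kernel_weight K n (h n) x i * g (scaled n i))"
  have eq: "gn eps g K h n x \<omega> = G + (\<Sum>i\<in>Lam n. kernel_weight K n (h n) x i * eps i \<omega>)" for \<omega>
    by (simp add: gn_def G_def kernel_weight_def sum_divide_distrib algebra_simps add_divide_distrib
        flip: sum.distrib)
  have "expectation (gn eps g K h n x) = G"
    unfolding eq[abs_def] using assms by (simp add: prob_space)
  then show ?thesis by (simp add: eq weighted_sum_def)
qed

lemma abs_divide_diff_divide_le:
  fixes a b s t :: real
  assumes "0 < s" "0 < t" "0 \<le> b"
  shows "\<bar>a / s - b / t\<bar> \<le> \<bar>a - b\<bar> / s + b * \<bar>t - s\<bar> / (s * t)"
proof -
  have "a / s - b / t = (a - b) / s + b * (t - s) / (s * t)"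
    using assms by (simp add: field_simps)
  also have "\<bar>\<dots>\<bar> \<le> \<bar>(a - b) / s\<bar> + \<bar>b * (t - s) / (s * t)\<bar>" by (rule abs_triangle_ineq)
  finally show ?thesis using assms by (simp add: abs_mult)
qed

locale bounded_kernel =
  fixes K :: "real^'d::finite \<Rightarrow> real" and \<eta> c C :: real
  assumes support: "K x \<noteq> 0 \<Longrightarrow> maxnorm x \<le> 1"
    and \<eta>_pos: "0 < \<eta>"
    and lipschitz: "maxnorm x \<le> 1 \<Longrightarrow> maxnorm y \<le> 1 \<Longrightarrow> \<bar>K x - K y\<bar> \<le> \<eta> * maxnorm (x - y)"
    and c_pos: "0 < c" and lower_bound: "maxnorm x \<le> 1 \<Longrightarrow> c \<le> K x"
    and C_pos: "0 < C" and upper_bound: "maxnorm x \<le> 1 \<Longrightarrow> K x \<le> C"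
begin

abbreviation kernel_at :: "nat \<Rightarrow> real \<Rightarrow> real^'d \<Rightarrow> int^'d \<Rightarrow> real" where
  "kernel_at n h x i \<equiv> K ((1 / h) *\<^sub>R (x - scaled n i))"

lemma kernel_weight_outside: "i \<in> Lam n \<Longrightarrow> i \<notin> window n h x \<Longrightarrow> kernel_weight K n h x i = 0"
  using support by (auto simp: kernel_weight_def window_def)

lemma kernel_weight_eq:
  "kernel_weight K n h x i = kernel_at n h x i / (\<Sum>j\<in>window n h x. kernel_at n h x j)"
proof -
  have "(\<Sum>j\<in>Lam n. kernel_at n h x j) = (\<Sum>j\<in>window n h x. kernel_at n h x j)"
    using support by (intro sum.mono_neutral_right finite_Lam) (auto simp: window_def)
  then show ?thesis by (simp add: kernel_weight_def)
qed

lemma weighted_sum_Lam_eq_window: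
  "weighted_sum (kernel_weight K n h x) eps (Lam n)
    = weighted_sum (kernel_weight K n h x) eps (window n h x)"
  unfolding weighted_sum_def
  by (intro ext sum.mono_neutral_right finite_Lam)
     (auto simp: kernel_weight_outside, simp add: window_def)

lemma sum_kernel_ge: "c * real (card (window n h x)) \<le> (\<Sum>j\<in>window n h x. kernel_at n h x j)"
  using sum_mono[of "window n h x" "\<lambda>_. c" "kernel_at n h x"] lower_bound
  by (simp add: window_def mult.commute)

lemma abs_kernel_weight_le:
  assumes "i \<in> window n h x"
  shows "\<bar>kernel_weight K n h x i\<bar> \<le> C / (c * real (card (window n h x)))"
proof -
  have "0 < card (window n h x)" using assms finite_window by (auto simp: card_gt_0_iff)
  then have pos: "0 < c * real (card (window n h x))" using c_pos by simp
  have kernel_bounds: "c \<le> kernel_at n h x i" "kernel_at n h x i \<le> C"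
    using assms lower_bound upper_bound by (auto simp: window_def)
  have "kernel_at n h x i / (\<Sum>j\<in>window n h x. kernel_at n h x j) \<le> C / (c * real (card (window n h x)))"
    using kernel_bounds pos c_pos C_pos sum_kernel_ge by (intro frac_le) auto
  moreover have "0 \<le> kernel_at n h x i / (\<Sum>j\<in>window n h x. kernel_at n h x j)"
    using kernel_bounds pos c_pos sum_kernel_ge[of n h x] by simp
  ultimately show ?thesis by (simp add: kernel_weight_eq)
qed

lemma abs_kernel_at_diff_le:
  assumes "0 < h" and "j \<in> window n h x" "j \<in> window n h y" and close: "\<And>k. \<bar>x $ k - y $ k\<bar> \<le> \<delta>"
  shows "\<bar>kernel_at n h x j - kernel_at n h y j\<bar> \<le> \<eta> * (\<delta> / h)"
proof -
  have "\<bar>kernel_at n h x j - kernel_at n h y j\<bar>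
      \<le> \<eta> * maxnorm ((1 / h) *\<^sub>R (x - scaled n j) - (1 / h) *\<^sub>R (y - scaled n j))"
    using assms(2,3) by (intro lipschitz) (auto simp: window_def)
  also have "(1 / h) *\<^sub>R (x - scaled n j) - (1 / h) *\<^sub>R (y - scaled n j) = (1 / h) *\<^sub>R (x - y)"
    by (simp flip: scaleR_diff_right)
  also have "maxnorm ((1 / h) *\<^sub>R (x - y)) \<le> \<delta> / h"
    using close assms(1) by (auto simp: maxnorm_le_iff abs_mult divide_right_mono)
  finally show ?thesis using \<eta>_pos by simp
qed

definition weight_lipschitz :: real where
  "weight_lipschitz = (1 / c + C / c\<^sup>2) * \<eta>"

lemma weight_lipschitz_pos: "0 < weight_lipschitz"
  using c_pos C_pos \<eta>_pos by (auto simp: weight_lipschitz_def intro!: mult_pos_pos add_pos_pos)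

lemma kernel_weight_diff_le_in_window:
  assumes h: "0 < h" and same: "window n h y = window n h x"
    and close: "\<And>k. \<bar>x $ k - y $ k\<bar> \<le> \<delta>" and i: "i \<in> window n h x"
  shows "\<bar>kernel_weight K n h x i - kernel_weight K n h y i\<bar> \<le> weight_lipschitz * (\<delta> / h)"
proof -
  define D where "D = \<eta> * (\<delta> / h)"
  define N where "N = real (card (window n h x))"
  define s where "s = (\<Sum>j\<in>window n h x. kernel_at n h x j)"
  define t where "t = (\<Sum>j\<in>window n h x. kernel_at n h y j)"
  have diff: "\<bar>kernel_at n h x j - kernel_at n h y j\<bar> \<le> D" if "j \<in> window n h x" for j
    unfolding D_def using h that close by (intro abs_kernel_at_diff_le) (auto simp: same)
  have D: "0 \<le> D" using diff[OF i] by linarith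
  have N: "1 \<le> N" using i finite_window[of n h x] by (auto simp: N_def Suc_le_eq card_gt_0_iff)
  have cN: "0 < c * N" using c_pos N by simp
  have sums_ge: "c * N \<le> s" "c * N \<le> t"
    using sum_kernel_ge[of n h x] sum_kernel_ge[of n h y] by (auto simp: s_def t_def N_def same)
  have "\<bar>s - t\<bar> \<le> (\<Sum>j\<in>window n h x. D)"
    unfolding s_def t_def sum_subtractf[symmetric] by (rule order_trans[OF sum_abs sum_mono[OF diff]])
  then have sum_diff: "\<bar>t - s\<bar> \<le> N * D" by (simp add: N_def abs_minus_commute)
  have "i \<in> window n h y" using i same by simp
  then have "maxnorm ((1 / h) *\<^sub>R (y - scaled n i)) \<le> 1" by (simp add: window_def)
  then have kernel_bounds: "0 \<le> kernel_at n h y i" "kernel_at n h y i \<le> C"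
    using c_pos lower_bound upper_bound by (auto intro: order_trans less_imp_le)
  have "\<bar>kernel_weight K n h x i - kernel_weight K n h y i\<bar>
      = \<bar>kernel_at n h x i / s - kernel_at n h y i / t\<bar>"
    by (simp add: kernel_weight_eq s_def t_def same)
  also have "\<dots> \<le> \<bar>kernel_at n h x i - kernel_at n h y i\<bar> / s + kernel_at n h y i * \<bar>t - s\<bar> / (s * t)"
    using cN sums_ge kernel_bounds by (intro abs_divide_diff_divide_le) auto
  also have "\<dots> \<le> D / (c * N) + C * (N * D) / ((c * N) * (c * N))"
    using sums_ge cN kernel_bounds diff[OF i] sum_diff C_pos D N
    by (intro add_mono frac_le mult_mono) auto
  also have "\<dots> = (1 / c + C / c\<^sup>2) * D / N"
    using c_pos N by (simp add: field_simps power2_eq_square)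
  also have "\<dots> \<le> (1 / c + C / c\<^sup>2) * D / 1"
    using N D c_pos C_pos by (intro divide_left_mono) auto
  finally show ?thesis by (simp add: D_def weight_lipschitz_def)
qed

lemma kernel_weight_diff_le:
  assumes h: "0 < h" and same: "window n h y = window n h x"
    and close: "\<And>k. \<bar>x $ k - y $ k\<bar> \<le> \<delta>" and i: "i \<in> Lam n"
  shows "\<bar>kernel_weight K n h x i - kernel_weight K n h y i\<bar> \<le> weight_lipschitz * (\<delta> / h)"
proof (cases "i \<in> window n h x")
  case True
  with h same close show ?thesis by (rule kernel_weight_diff_le_in_window)
next
  case False
  have "0 \<le> \<delta>" using close[of undefined] by linarith
  then show ?thesis
    using False h same kernel_weight_outside[OF i] weight_lipschitz_pos by simp
qed

lemma weighted_sum_diff_le: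
  assumes "0 < h" "window n h y = window n h x" "\<And>k. \<bar>x $ k - y $ k\<bar> \<le> \<delta>"
  shows "\<bar>weighted_sum (kernel_weight K n h x) eps (Lam n) \<omega>
      - weighted_sum (kernel_weight K n h y) eps (Lam n) \<omega>\<bar>
    \<le> weight_lipschitz * (\<delta> / h) * (\<Sum>i\<in>Lam n. \<bar>eps i \<omega>\<bar>)"
proof -
  have "weighted_sum (kernel_weight K n h x) eps (Lam n) \<omega>
        - weighted_sum (kernel_weight K n h y) eps (Lam n) \<omega>
      = (\<Sum>i\<in>Lam n. (kernel_weight K n h x i - kernel_weight K n h y i) * eps i \<omega>)"
    by (simp add: weighted_sum_def left_diff_distrib sum_subtractf)
  also have "\<bar>\<dots>\<bar> \<le> (\<Sum>i\<in>Lam n. \<bar>(kernel_weight K n h x i - kernel_weight K n h y i) * eps i \<omega>\<bar>)"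
    by (rule sum_abs)
  also have "\<dots> \<le> (\<Sum>i\<in>Lam n. weight_lipschitz * (\<delta> / h) * \<bar>eps i \<omega>\<bar>)"
    unfolding abs_mult by (intro sum_mono mult_right_mono kernel_weight_diff_le assms) auto
  finally show ?thesis by (simp add: sum_distrib_left)
qed

end

lemma A1_imp_bounded_kernel:
  assumes "A1 K"
  obtains \<eta> c C where "bounded_kernel K \<eta> c C"
  using assms unfolding A1_def bounded_kernel_def by metis

subsection \<open>A net of the unit cube\<close>

text \<open>The kernel jumps at the boundary of its support, so points of one cell have to see
  exactly the same sites. This costs only polynomially many cells, since
  the window of \<open>x\<close> is fixed by two integers per coordinate.\<close>
definition cell_code :: "nat \<Rightarrow> real \<Rightarrow> nat \<Rightarrow> real^'d::finite \<Rightarrow> 'd \<Rightarrow> int \<times> int \<times> int" where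
  "cell_code n h r x k = (\<lceil>real n * (x $ k - h)\<rceil>, \<lfloor>real n * (x $ k + h)\<rfloor>, \<lfloor>real n ^ r * x $ k\<rfloor>)"

definition cell_net :: "nat \<Rightarrow> real \<Rightarrow> nat \<Rightarrow> (real^'d::finite) set" where
  "cell_net n h r = inv_into unit_cube (cell_code n h r) ` cell_code n h r ` unit_cube"

lemma cell_net_subset: "cell_net n h r \<subseteq> unit_cube"
  by (auto simp: cell_net_def intro: inv_into_into)

lemma cell_code_mem:
  assumes "0 \<le> h" "h \<le> 1" and "x \<in> unit_cube"
  shows "cell_code n h r x k \<in> {- int n..int n} \<times> {0..2 * int n} \<times> {0..int n ^ r}"
proof -
  have x: "0 \<le> x $ k" "x $ k \<le> 1" using assms(3) by (auto simp: unit_cube_def)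
  then have "0 \<le> real n * x $ k" "real n * x $ k \<le> real n" "0 \<le> real n * h" "real n * h \<le> real n"
    "0 \<le> real n ^ r * x $ k" "real n ^ r * x $ k \<le> real n ^ r"
    using assms(1,2) by (auto simp: mult_left_le)
  then show ?thesis
    by (auto simp: cell_code_def ceiling_le_iff floor_le_iff le_floor_iff le_ceiling_iff
        right_diff_distrib distrib_left)
qed

lemma
  assumes "4 \<le> n" "0 \<le> h" "h \<le> 1"
  shows finite_cell_net: "finite (cell_net n h r :: (real^'d::finite) set)"
    and card_cell_net_le: "card (cell_net n h r :: (real^'d::finite) set) \<le> n ^ ((r + 5) * CARD('d))"
proof -
  let ?J = "{- int n..int n} \<times> {0..2 * int n} \<times> {0..int n ^ r}"
  let ?F = "PiE (UNIV :: 'd set) (\<lambda>_. ?J)"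
  have sub: "cell_code n h r ` (unit_cube :: (real^'d) set) \<subseteq> ?F"
    using cell_code_mem[OF assms(2,3)] by blast
  have finF: "finite ?F" by (intro finite_PiE) auto
  then have fin: "finite (cell_code n h r ` (unit_cube :: (real^'d) set))"
    using sub by (rule finite_subset[rotated])
  then show "finite (cell_net n h r :: (real^'d) set)" by (simp add: cell_net_def)
  have "4 * n \<le> n * n" using assms(1) by simp
  then have n2: "2 * n + 1 \<le> n * n" using assms(1) by linarith
  have "1 \<le> n ^ r" "4 * n ^ r \<le> n * n ^ r" using assms(1) by auto
  then have nr: "n ^ r + 1 \<le> n * n ^ r" by linarith
  have "card ?J = (2 * n + 1) * ((2 * n + 1) * (n ^ r + 1))"
    by (simp add: card_cartesian_product nat_add_distrib nat_mult_distrib nat_power_eq)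
  also have "\<dots> \<le> (n * n) * ((n * n) * (n * n ^ r))"
    by (intro mult_le_mono n2 nr)
  also have "\<dots> = n ^ (r + 5)" by (simp add: power_add eval_nat_numeral)
  finally have card_J: "card ?J \<le> n ^ (r + 5)" .
  have "card (cell_net n h r :: (real^'d) set) \<le> card ?F"
    unfolding cell_net_def using card_image_le[OF fin] card_mono[OF finF sub] by (rule order_trans)
  also have "\<dots> = card ?J ^ CARD('d)" by (subst card_PiE) auto
  also have "\<dots> \<le> (n ^ (r + 5)) ^ CARD('d)" using card_J by (rule power_mono) simp
  finally show "card (cell_net n h r :: (real^'d) set) \<le> n ^ ((r + 5) * CARD('d))"
    by (simp add: power_mult)
qed

lemma cell_code_eq_imp:
  assumes "0 < n" "0 < h" and eq: "cell_code n h r y = cell_code n h r x"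
  shows "window n h y = window n h x" and "\<bar>x $ k - y $ k\<bar> \<le> 1 / real n ^ r"
proof -
  have codes: "\<lceil>real n * (y $ k - h)\<rceil> = \<lceil>real n * (x $ k - h)\<rceil>"
    "\<lfloor>real n * (y $ k + h)\<rfloor> = \<lfloor>real n * (x $ k + h)\<rfloor>"
    "\<lfloor>real n ^ r * y $ k\<rfloor> = \<lfloor>real n ^ r * x $ k\<rfloor>" for k
    using fun_cong[OF eq, of k] by (auto simp: cell_code_def)
  show "window n h y = window n h x"
    using assms(1,2) by (simp add: window_eq codes)
  have "\<bar>real n ^ r * x $ k - real n ^ r * y $ k\<bar> \<le> 1" using codes(3)[of k] by linarith
  then have "real n ^ r * \<bar>x $ k - y $ k\<bar> \<le> 1"
    using assms(1) by (simp add: abs_mult flip: right_diff_distrib)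
  then show "\<bar>x $ k - y $ k\<bar> \<le> 1 / real n ^ r" using assms(1) by (simp add: field_simps)
qed

lemma cell_net_approximates:
  assumes "0 < n" "0 < h" "x \<in> unit_cube"
  obtains y where "y \<in> cell_net n h r" "window n h y = window n h x"
    "\<And>k. \<bar>x $ k - y $ k\<bar> \<le> 1 / real n ^ r"
proof
  let ?y = "inv_into unit_cube (cell_code n h r) (cell_code n h r x)"
  have eq: "cell_code n h r ?y = cell_code n h r x" using assms(3) by (intro f_inv_into_f imageI)
  show "?y \<in> cell_net n h r" using assms(3) by (simp add: cell_net_def)
  show "window n h ?y = window n h x" "\<bar>x $ k - ?y $ k\<bar> \<le> 1 / real n ^ r" for k
    using cell_code_eq_imp[OF assms(1,2) eq] by auto
qed

subsection \<open>Almost sure uniform rate\<close>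

lemma (in prob_space) AE_eventually_notin:
  assumes "\<And>n. A n \<in> events" and le: "eventually (\<lambda>n. prob (A n) \<le> b / real n ^ 2) sequentially"
  shows "AE \<omega> in M. eventually (\<lambda>n. \<omega> \<notin> A n) sequentially"
proof -
  have "summable (\<lambda>n. prob (A n))"
  proof (rule summable_comparison_test_ev)
    show "eventually (\<lambda>n. norm (prob (A n)) \<le> b * inverse (real n ^ 2)) sequentially"
      using le by eventually_elim (simp add: divide_inverse)
    show "summable (\<lambda>n. b * inverse (real n ^ 2))"
      by (intro summable_mult inverse_power_summable) simp
  qed
  then have "AE \<omega> in M. eventually (\<lambda>n. \<omega> \<in> space M - A n) sequentially"
    using assms(1) by (intro borel_cantelli_AE1) (auto simp: emeasure_eq_measure)
  then show ?thesis by eventually_elim (auto elim: eventually_mono)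
qed

lemma (in prob_space) AE_eventually_ball_not:
  assumes events: "\<And>n x. {\<omega> \<in> space M. P n x \<omega>} \<in> events" and "0 \<le> b"
    and le: "eventually (\<lambda>n. finite (Q n) \<and> card (Q n) \<le> n ^ k \<and>
      (\<forall>x\<in>Q n. prob {\<omega> \<in> space M. P n x \<omega>} \<le> b / real n ^ (k + 2))) sequentially"
  shows "AE \<omega> in M. eventually (\<lambda>n. \<forall>x\<in>Q n. \<not> P n x \<omega>) sequentially"
proof -
  define A where "A n = (if finite (Q n) then \<Union>x\<in>Q n. {\<omega> \<in> space M. P n x \<omega>} else {})" for n
  have prob_A_le: "prob (A n) \<le> b / real n ^ 2"
    if n: "1 \<le> n" and Q: "finite (Q n)" "card (Q n) \<le> n ^ k"
      and prob_le: "\<forall>x\<in>Q n. prob {\<omega> \<in> space M. P n x \<omega>} \<le> b / real n ^ (k + 2)" for n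
  proof -
    have "prob (A n) \<le> (\<Sum>x\<in>Q n. prob {\<omega> \<in> space M. P n x \<omega>})"
      using Q(1) events by (auto simp: A_def intro!: finite_measure_subadditive_finite)
    also have "\<dots> \<le> real (card (Q n)) * (b / real n ^ (k + 2))"
      using prob_le by (intro sum_bounded_above) auto
    also have "\<dots> \<le> real (n ^ k) * (b / real n ^ (k + 2))"
      using Q(2) \<open>0 \<le> b\<close> by (intro mult_right_mono of_nat_mono) auto
    also have "\<dots> = b / real n ^ 2" using n by (simp add: power_add power2_eq_square)
    finally show ?thesis .
  qed
  have "eventually (\<lambda>n. prob (A n) \<le> b / real n ^ 2) sequentially"
    using le eventually_ge_at_top[of 1] by eventually_elim (use prob_A_le in blast)
  moreover have "A n \<in> events" for n using events by (auto simp: A_def)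
  ultimately have "AE \<omega> in M. eventually (\<lambda>n. \<omega> \<notin> A n) sequentially" by (intro AE_eventually_notin)
  then show ?thesis
    using AE_space
  proof eventually_elim
    case (elim \<omega>)
    from elim(1) le show ?case by eventually_elim (use elim(2) in \<open>auto simp: A_def\<close>)
  qed
qed

lemma limsup_SUP_divide_le:
  fixes f :: "nat \<Rightarrow> 'b \<Rightarrow> real"
  assumes "eventually (\<lambda>n. 0 < v n) sequentially"
    and "eventually (\<lambda>n. \<forall>x\<in>U. \<bar>f n x\<bar> \<le> lam * v n) sequentially"
  shows "limsup (\<lambda>n. (SUP x\<in>U. ereal \<bar>f n x\<bar>) / ereal (v n)) \<le> ereal lam"
proof (rule Limsup_bounded)
  show "eventually (\<lambda>n. (SUP x\<in>U. ereal \<bar>f n x\<bar>) / ereal (v n) \<le> ereal lam) sequentially"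
    using assms
  proof eventually_elim
    case (elim n)
    then have "(SUP x\<in>U. ereal \<bar>f n x\<bar>) \<le> ereal (v n) * ereal lam"
      by (intro SUP_least) (simp add: mult.commute)
    then show ?case using elim by (subst ereal_divide_le_pos) auto
  qed
qed

definition rate :: "real \<Rightarrow> nat \<Rightarrow> nat \<Rightarrow> real \<Rightarrow> real" where
  "rate \<gamma> d n h = ln (real n) powr \<gamma> / (real n * h) powr (real d / 2)"

lemma one_le_ln_of_admissible: "admissible_bandwidth n h \<Longrightarrow> 1 \<le> ln (real n)"
  using exp_le by (subst ln_ge_iff) (auto simp: admissible_bandwidth_def intro: order_trans)

lemma inverse_power_le_rate:
  assumes adm: "admissible_bandwidth n h" and "0 \<le> \<gamma>"
  shows "1 / real n ^ d \<le> rate \<gamma> d n h"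
proof -
  have n: "1 \<le> real n" "real n * h \<le> real n" "0 < real n * h"
    using adm by (auto simp: admissible_bandwidth_def mult_left_le)
  have "(real n * h) powr (real d / 2) \<le> real n powr (real d / 2)"
    using n by (intro powr_mono2) auto
  also have "\<dots> \<le> real n powr real d" using n by (intro powr_mono) auto
  also have "\<dots> = real n ^ d" using n by (simp add: powr_realpow)
  finally have "(real n * h) powr (real d / 2) \<le> real n ^ d" .
  moreover have "1 \<le> ln (real n) powr \<gamma>"
    using one_le_ln_of_admissible[OF adm] assms(2) by (intro ge_one_powr_ge_zero) auto
  ultimately show ?thesis unfolding rate_def using n by (intro frac_le) auto
qed

lemma rate_pos: "admissible_bandwidth n h \<Longrightarrow> 0 \<le> \<gamma> \<Longrightarrow> 0 < rate \<gamma> d n h"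
  by (rule less_le_trans[OF _ inverse_power_le_rate[where d = d]]) (auto simp: admissible_bandwidth_def)

lemma powr_div_sqrt_le_rate:
  assumes "0 < real n * h" "(real n * h / 2) ^ d \<le> N" "0 \<le> \<gamma>" "0 \<le> t" "t \<le> 4 * ln (real n)"
  shows "t powr \<gamma> / sqrt N \<le> 2 powr (real d / 2) * 4 powr \<gamma> * rate \<gamma> d n h"
proof -
  have "0 < n" using assms(1) by (cases n) auto
  have "(real n * h / 2) powr (real d / 2) = sqrt ((real n * h / 2) ^ d)"
    using assms(1) by (simp add: powr_powr flip: powr_half_sqrt powr_realpow)
  also have "\<dots> \<le> sqrt N" using assms(2) by simp
  finally have "t powr \<gamma> / sqrt N \<le> (4 * ln (real n)) powr \<gamma> / (real n * h / 2) powr (real d / 2)"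
    using assms \<open>0 < n\<close> by (intro frac_le powr_mono2) auto
  also have "\<dots> = 2 powr (real d / 2) * 4 powr \<gamma> * rate \<gamma> d n h"
    using assms(1,4,5) \<open>0 < n\<close> by (simp add: rate_def powr_mult powr_divide zero_less_mult_iff)
  finally show ?thesis .
qed

locale kernel_smoothing = prob_space M + bounded_kernel K \<eta> c C
  for M :: "'a measure" and K :: "real^'d::finite \<Rightarrow> real" and \<eta> c C :: real +
  fixes eps :: "int^'d \<Rightarrow> 'a \<Rightarrow> real" and \<gamma> L :: real
  assumes \<gamma>_nonneg: "0 \<le> \<gamma>" and L_pos: "0 < L" and growth: "moment_growth M eps \<gamma> L"
begin

definition noise :: "nat \<Rightarrow> real \<Rightarrow> real^'d \<Rightarrow> 'a \<Rightarrow> real" where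
  "noise n h x = weighted_sum (kernel_weight K n h x) eps (Lam n)"

lemma all_moments_noise: "all_moments M (noise n h x)"
  unfolding noise_def using growth by (intro all_moments_weighted_sum) (simp add: moment_growth_def)

lemma noise_measurable [measurable]: "noise n h x \<in> borel_measurable M"
  by (rule all_momentsD(1)[OF all_moments_noise])

lemma eps_measurable [measurable]: "eps i \<in> borel_measurable M"
  using growth by (auto simp: moment_growth_def intro: all_momentsD(1))

lemma Lp_norm_noise_le:
  assumes m: "1 \<le> m" and "window n h x \<noteq> {}"
  shows "Lp_norm M (2 * m) (noise n h x)
    \<le> L * (C / c) * (real (2 * m) powr \<gamma> / sqrt (real (card (window n h x))))"
proof -
  define N where "N = real (card (window n h x))"
  have N: "0 < N" using assms(2) finite_window by (simp add: N_def card_gt_0_iff)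
  have "Lp_norm M (2 * m) (noise n h x) \<le> L * (C / (c * N)) * sqrt N * real (2 * m) powr \<gamma>"
    using growth m finite_window[of n h x] abs_kernel_weight_le
    unfolding moment_growth_def noise_def weighted_sum_Lam_eq_window N_def by blast
  also have "\<dots> = L * (C / c) * (real (2 * m) powr \<gamma> * (sqrt N / N))" by simp
  also have "sqrt N / N = 1 / sqrt N" using N by (simp add: real_div_sqrt field_simps)
  finally show ?thesis by (simp add: N_def)
qed

definition deviation_const :: "nat \<Rightarrow> real" where
  "deviation_const k = exp (real k / 2) * (L * (C / c) * (2 powr (real CARD('d) / 2) * 4 powr \<gamma>))"

lemma deviation_const_pos: "0 < deviation_const k"
  using L_pos c_pos C_pos by (simp add: deviation_const_def)

lemma prob_noise_ge_le:
  assumes adm: "admissible_bandwidth n h" and x: "x \<in> unit_cube"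
  shows "prob {\<omega> \<in> space M. deviation_const k * rate \<gamma> CARD('d) n h \<le> \<bar>noise n h x \<omega>\<bar>} \<le> 1 / real n ^ k"
proof -
  define m where "m = nat \<lceil>ln (real n)\<rceil>"
  define N where "N = real (card (window n h x))"
  define s where "s = L * (C / c) * (2 powr (real CARD('d) / 2) * 4 powr \<gamma>) * rate \<gamma> CARD('d) n h"
  have m: "1 \<le> m" "ln (real n) \<le> real m" "real (2 * m) \<le> 4 * ln (real n)"
    using one_le_ln_of_admissible[OF adm] unfolding m_def by linarith+
  have n: "0 < real n" "0 < real n * h" using adm by (auto simp: admissible_bandwidth_def)
  have N: "(real n * h / 2) ^ CARD('d) \<le> N" unfolding N_def by (rule card_window_ge[OF adm x])
  have "0 < (real n * h / 2) ^ CARD('d)" using n by simp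
  then have ne: "window n h x \<noteq> {}" using N by (auto simp: N_def)
  have s: "0 < s" using L_pos c_pos C_pos rate_pos[OF adm \<gamma>_nonneg] by (simp add: s_def)
  have "Lp_norm M (2 * m) (noise n h x) \<le> L * (C / c) * (real (2 * m) powr \<gamma> / sqrt N)"
    unfolding N_def by (rule Lp_norm_noise_le[OF m(1) ne])
  also have "\<dots> \<le> s"
    unfolding s_def mult.assoc[of "L * (C / c)"] using L_pos c_pos C_pos n N m \<gamma>_nonneg
    by (intro mult_left_mono powr_div_sqrt_le_rate) auto
  finally have norm_le: "Lp_norm M (2 * m) (noise n h x) \<le> s" .
  have "prob {\<omega> \<in> space M. exp (real k / 2) * s \<le> \<bar>noise n h x \<omega>\<bar>}
      \<le> (Lp_norm M (2 * m) (noise n h x) / (exp (real k / 2) * s)) ^ (2 * m)"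
    using m(1) s by (intro measure_abs_ge_le_Lp_norm all_moments_noise) auto
  also have "\<dots> \<le> (s / (exp (real k / 2) * s)) ^ (2 * m)"
    using s norm_le by (intro power_mono divide_right_mono) (auto simp: Lp_norm_nonneg)
  also have "\<dots> = exp (- (real k * real m))"
    using s by (simp add: exp_minus field_simps flip: exp_of_nat_mult)
  also have "\<dots> \<le> exp (- (real k * ln (real n)))" using m(2) by (simp add: mult_left_mono)
  also have "\<dots> = 1 / real n ^ k"
    using n by (simp only: exp_minus exp_of_nat_mult exp_ln inverse_eq_divide)
  finally show ?thesis by (simp add: s_def deviation_const_def mult.assoc)
qed

lemma prob_eps_ge_le:
  assumes "0 < t"
  shows "prob {\<omega> \<in> space M. t \<le> \<bar>eps i \<omega>\<bar>} \<le> (L * 2 powr \<gamma> / t)\<^sup>2"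
proof -
  have "Lp_norm M 2 (weighted_sum (\<lambda>_. 1) eps {i})
      \<le> L * 1 * sqrt (real (card {i})) * real (2 * 1) powr \<gamma>"
    using growth[unfolded moment_growth_def, THEN conjunct2, rule_format, of 1 "{i}" "\<lambda>_. 1" 1] by simp
  then have "Lp_norm M 2 (eps i) \<le> L * 2 powr \<gamma>" by (simp add: weighted_sum_def[abs_def])
  then have "(Lp_norm M 2 (eps i) / t) ^ 2 \<le> (L * 2 powr \<gamma> / t)\<^sup>2"
    using assms by (intro power_mono divide_right_mono) (auto simp: Lp_norm_nonneg)
  moreover have "prob {\<omega> \<in> space M. t \<le> \<bar>eps i \<omega>\<bar>} \<le> (Lp_norm M 2 (eps i) / t) ^ 2"
    using growth assms by (intro measure_abs_ge_le_Lp_norm) (auto simp: moment_growth_def)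
  ultimately show ?thesis by linarith
qed

lemma abs_noise_le_of_cell_net:
  assumes adm: "admissible_bandwidth n h" and x: "x \<in> unit_cube"
    and net: "\<And>y. y \<in> cell_net n h (3 * CARD('d) + 2) \<Longrightarrow> \<bar>noise n h y \<omega>\<bar> \<le> a * rate \<gamma> CARD('d) n h"
    and sites: "\<And>i. i \<in> Lam n \<Longrightarrow> \<bar>eps i \<omega>\<bar> \<le> real n ^ (CARD('d) + 1)"
  shows "\<bar>noise n h x \<omega>\<bar> \<le> (a + weight_lipschitz) * rate \<gamma> CARD('d) n h"
proof -
  let ?d = "CARD('d)" and ?r = "3 * CARD('d) + 2"
  have n: "0 < n" "0 < h" "1 \<le> real n * h" using adm by (auto simp: admissible_bandwidth_def)
  obtain y where y: "y \<in> cell_net n h ?r" "window n h y = window n h x"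
    "\<And>k. \<bar>x $ k - y $ k\<bar> \<le> 1 / real n ^ ?r" using cell_net_approximates[OF n(1,2) x, of ?r] by blast
  have "(\<Sum>i\<in>(Lam n :: (int^'d) set). \<bar>eps i \<omega>\<bar>)
      \<le> real (card (Lam n :: (int^'d) set)) * real n ^ (?d + 1)"
    by (intro sum_bounded_above sites)
  then have sum_le: "(\<Sum>i\<in>(Lam n :: (int^'d) set). \<bar>eps i \<omega>\<bar>) \<le> real n ^ ?d * real n ^ (?d + 1)"
    by (simp add: card_Lam)
  have "\<bar>noise n h x \<omega> - noise n h y \<omega>\<bar>
      \<le> weight_lipschitz * (1 / real n ^ ?r / h) * (\<Sum>i\<in>Lam n. \<bar>eps i \<omega>\<bar>)"
    unfolding noise_def by (rule weighted_sum_diff_le[OF n(2) y(2,3)])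
  also have "\<dots> \<le> weight_lipschitz * (1 / real n ^ ?r / h) * (real n ^ ?d * real n ^ (?d + 1))"
    using weight_lipschitz_pos n by (intro mult_left_mono sum_le) auto
  also have "\<dots> = weight_lipschitz * (1 / real n ^ ?d / (real n * h))"
  proof -
    have "?r = ?d + (?d + 1) + (?d + 1)" by simp
    then have "real n ^ ?r = real n ^ ?d * real n ^ (?d + 1) * (real n ^ ?d * real n)"
      by (simp only: power_add power_one_right)
    then show ?thesis using n by simp
  qed
  also have "\<dots> \<le> weight_lipschitz * (1 / real n ^ ?d)"
    using n weight_lipschitz_pos by (intro mult_left_mono) (auto simp: divide_le_eq mult_left_le)
  also have "\<dots> \<le> weight_lipschitz * rate \<gamma> ?d n h"
    using weight_lipschitz_pos by (intro mult_left_mono inverse_power_le_rate[OF adm \<gamma>_nonneg]) auto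
  finally show ?thesis using net[OF y(1)] by (simp add: distrib_right)
qed

lemma AE_eventually_noise_less_on_cell_net:
  assumes adm: "eventually (\<lambda>n. admissible_bandwidth n (h n)) sequentially"
  shows "AE \<omega> in M. eventually (\<lambda>n. \<forall>y\<in>cell_net n (h n) r. \<not>
    deviation_const ((r + 5) * CARD('d) + 2) * rate \<gamma> CARD('d) n (h n) \<le> \<bar>noise n (h n) y \<omega>\<bar>)
    sequentially"
proof (rule AE_eventually_ball_not[where k = "(r + 5) * CARD('d)" and b = 1])
  let ?k = "(r + 5) * CARD('d)"
  show "eventually (\<lambda>n. finite (cell_net n (h n) r :: (real^'d) set) \<and>
      card (cell_net n (h n) r :: (real^'d) set) \<le> n ^ ?k \<and>
      (\<forall>y\<in>cell_net n (h n) r. prob {\<omega> \<in> space M.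
        deviation_const (?k + 2) * rate \<gamma> CARD('d) n (h n) \<le> \<bar>noise n (h n) y \<omega>\<bar>}
        \<le> 1 / real n ^ (?k + 2))) sequentially"
    using adm
  proof eventually_elim
    case (elim n)
    then have n: "4 \<le> n" "0 \<le> h n" "h n \<le> 1" by (auto simp: admissible_bandwidth_def)
    show ?case
      using finite_cell_net[OF n] card_cell_net_le[OF n] prob_noise_ge_le[OF elim] cell_net_subset
      by blast
  qed
qed auto

lemma AE_eventually_eps_less_power:
  "AE \<omega> in M. eventually (\<lambda>n. \<forall>i\<in>Lam n. \<not> real n ^ (CARD('d) + 1) \<le> \<bar>eps i \<omega>\<bar>) sequentially"
proof (rule AE_eventually_ball_not[where k = "CARD('d)" and b = "(L * 2 powr \<gamma>)\<^sup>2"])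
  let ?d = "CARD('d)"
  have "prob {\<omega> \<in> space M. real n ^ (?d + 1) \<le> \<bar>eps i \<omega>\<bar>} \<le> (L * 2 powr \<gamma>)\<^sup>2 / real n ^ (?d + 2)"
    if "1 \<le> n" for n i
  proof -
    have "prob {\<omega> \<in> space M. real n ^ (?d + 1) \<le> \<bar>eps i \<omega>\<bar>} \<le> (L * 2 powr \<gamma> / real n ^ (?d + 1))\<^sup>2"
      using that by (intro prob_eps_ge_le) auto
    also have "\<dots> = (L * 2 powr \<gamma>)\<^sup>2 / real n ^ ((?d + 1) * 2)"
      by (simp only: power_divide power_mult)
    also have "\<dots> \<le> (L * 2 powr \<gamma>)\<^sup>2 / real n ^ (?d + 2)"
      using that by (intro divide_left_mono power_increasing) auto
    finally show ?thesis .
  qed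
  then show "eventually (\<lambda>n. finite (Lam n :: (int^'d) set) \<and> card (Lam n :: (int^'d) set) \<le> n ^ ?d \<and>
      (\<forall>i\<in>(Lam n :: (int^'d) set). prob {\<omega> \<in> space M. real n ^ (?d + 1) \<le> \<bar>eps i \<omega>\<bar>}
        \<le> (L * 2 powr \<gamma>)\<^sup>2 / real n ^ (?d + 2))) sequentially"
    by (intro eventually_mono[OF eventually_ge_at_top[of 1]]) (simp add: finite_Lam card_Lam)
qed auto

theorem AE_eventually_abs_noise_le:
  assumes adm: "eventually (\<lambda>n. admissible_bandwidth n (h n)) sequentially"
  obtains lam where "0 < lam"
    "AE \<omega> in M. eventually (\<lambda>n. \<forall>x\<in>unit_cube. \<bar>noise n (h n) x \<omega>\<bar> \<le> lam * rate \<gamma> CARD('d) n (h n))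
      sequentially"
proof
  let ?r = "3 * CARD('d) + 2"
  let ?a = "deviation_const ((?r + 5) * CARD('d) + 2)"
  show "0 < ?a + weight_lipschitz" by (intro add_pos_pos deviation_const_pos weight_lipschitz_pos)
  show "AE \<omega> in M. eventually (\<lambda>n. \<forall>x\<in>unit_cube.
      \<bar>noise n (h n) x \<omega>\<bar> \<le> (?a + weight_lipschitz) * rate \<gamma> CARD('d) n (h n)) sequentially"
    using AE_eventually_noise_less_on_cell_net[OF adm, of ?r] AE_eventually_eps_less_power
  proof eventually_elim
    case (elim \<omega>)
    from elim adm show ?case
    proof eventually_elim
      case (elim n)
      then show ?case by (intro ballI abs_noise_le_of_cell_net) (auto simp: not_le intro: less_imp_le)
    qed
  qed
qed

corollary AE_limsup_SUP_abs_noise_le: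
  assumes adm: "eventually (\<lambda>n. admissible_bandwidth n (h n)) sequentially"
  obtains lam where "0 < lam"
    "AE \<omega> in M. limsup (\<lambda>n. (SUP x\<in>unit_cube. ereal \<bar>noise n (h n) x \<omega>\<bar>)
      / ereal (rate \<gamma> CARD('d) n (h n))) \<le> ereal lam"
proof -
  obtain lam where "0 < lam" and lam: "AE \<omega> in M. eventually (\<lambda>n. \<forall>x\<in>unit_cube.
      \<bar>noise n (h n) x \<omega>\<bar> \<le> lam * rate \<gamma> CARD('d) n (h n)) sequentially"
    using AE_eventually_abs_noise_le[OF adm] .
  have eventually_rate_pos: "eventually (\<lambda>n. 0 < rate \<gamma> CARD('d) n (h n)) sequentially"
    using adm by eventually_elim (rule rate_pos[OF _ \<gamma>_nonneg])
  show thesis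
  proof (rule that[OF \<open>0 < lam\<close>])
    show "AE \<omega> in M. limsup (\<lambda>n. (SUP x\<in>unit_cube. ereal \<bar>noise n (h n) x \<omega>\<bar>)
        / ereal (rate \<gamma> CARD('d) n (h n))) \<le> ereal lam"
      using lam by eventually_elim (rule limsup_SUP_divide_le[OF eventually_rate_pos])
  qed
qed

end

lemma beta_of_pos: "0 < q \<Longrightarrow> q < 2 \<Longrightarrow> 0 < beta_of q"
  by (simp add: beta_of_def)

lemma half_plus_inverse_beta_of: "0 < q \<Longrightarrow> q < 2 \<Longrightarrow> 1 / 2 + 1 / beta_of q = 1 / q"
  by (simp add: beta_of_def field_simps)

lemma C2_imp_moment_growth:
  assumes "stationary_field M eps" and "0 < q" "q < 2" "C2 M eps q"
  obtains L where "0 < L" "moment_growth M eps (1 / q) L"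
proof -
  interpret stationary_field M eps by fact
  interpret orlicz_field M eps "beta_of q"
    using assms beta_of_pos by unfold_locales (auto simp: C2_def)
  show thesis using that moment_growth_field half_plus_inverse_beta_of[OF assms(2,3)] by metis
qed

theorem theorem1:
  fixes M :: "'a measure"
    and eps :: "(int, 'd::{finite,linorder}) vec \<Rightarrow> 'a \<Rightarrow> real"
    and g :: "(real, 'd) vec \<Rightarrow> real"
    and K :: "(real, 'd) vec \<Rightarrow> real"
    and h :: "nat \<Rightarrow> real"
    and q :: real
  assumes "prob_space M"
    and "\<And>i. eps i \<in> borel_measurable M"
    and "strictly_stationary M eps"
    and "integrable M (eps 0)" and "integral\<^sup>L M (eps 0) = 0"
    and "prob_density K" and "A1 K"
    and "\<And>n. h n > 0" and "h \<longlonglongrightarrow> 0"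
    and "filterlim (\<lambda>n. real n * h n) at_top sequentially"
    and "0 < q" and "q < 2" and "C2 M eps q"
  shows "\<exists>lam>0. AE \<omega> in M.
           limsup (\<lambda>n. (SUP x\<in>unit_cube. ereal \<bar>gn eps g K h n x \<omega> - integral\<^sup>L M (gn eps g K h n x)\<bar>)
                        / ereal (ln (real n) powr (1 / q) / (real n * h n) powr (real CARD('d) / 2)))
           \<le> ereal lam"
proof -
  interpret stationary_field M eps
    using assms(1-3) by (simp add: stationary_field_def stationary_field_axioms_def)
  obtain L where L: "0 < L" "moment_growth M eps (1 / q) L"
    using C2_imp_moment_growth[OF stationary_field_axioms assms(11-13)] .
  obtain \<eta> c C where "bounded_kernel K \<eta> c C"
    using A1_imp_bounded_kernel[OF assms(7)] .
  then interpret bounded_kernel K \<eta> c C .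
  interpret kernel_smoothing M K \<eta> c C eps "1 / q" L
    by unfold_locales (use assms(11) L in auto)
  obtain lam where "0 < lam" and lam: "AE \<omega> in M. limsup (\<lambda>n.
      (SUP x\<in>unit_cube. ereal \<bar>noise n (h n) x \<omega>\<bar>) / ereal (rate (1 / q) CARD('d) n (h n))) \<le> ereal lam"
    using AE_limsup_SUP_abs_noise_le[OF eventually_admissible_bandwidth[OF assms(8-10)]] .
  have "gn eps g K h n x \<omega> - expectation (gn eps g K h n x) = noise n (h n) x \<omega>" for n x \<omega>
    unfolding noise_def using L(2) assms(5) integral_eps
    by (intro gn_minus_expectation) (auto simp: moment_growth_def intro: all_momentsD(3))
  then show ?thesis using \<open>0 < lam\<close> lam unfolding rate_def by auto
qed

end
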